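(* Let $\mathbf{V}$ be a nontrivial extension-closed pseudovariety of finite groups and let $F$ be a free group. Let $w \in F\setminus\{1\}$, $u = \mathrm{root}(w)$ and $e = \mathrm{exp}(w)$. Then: (i) $\mathrm{Cl}_{\mathbf{V}}(\langle 1\rangle) = \langle 1\rangle$; (ii) $\mathrm{Cl}_{\mathbf{V}}(\langle w\rangle) \leq \langle u\rangle$; (iii) $\langle w\rangle$ is $\mathbf{V}$-closed if and only if $C_e \in \mathbf{V}$; (iv) $\mathrm{Cl}_{\mathbf{V}}(\langle w\rangle) = \langle u^m\rangle$ for $m = \max\{ k \geq 1 \mid k \text{ divides } e \text{ and } C_k \in \mathbf{V}\}$; (v) if it is decidable, for each $n \geq 2$, whether or not $C_n \in \mathbf{V}$, then $\mathrm{Cl}_{\mathbf{V}}(\langle w\rangle)$ is effectively computable.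
   Context: A pseudovariety of finite groups is a class of finite groups closed under taking subgroups, homomorphic images and finitary direct products. It is nontrivial if it contains some nontrivial group, and extension-closed if for every finite group $G$ and every $N \unlhd G$, $N \in \mathbf{V}$ and $G/N \in \mathbf{V}$ imply $G \in \mathbf{V}$. The pro-$\mathbf{V}$ topology on a group $G$ is the coarsest topology making all homomorphisms from $G$ into (discrete) members of $\mathbf{V}$ continuous; equivalently, $G$ is a topological group in which the normal subgroups $K$ with $G/K \in \mathbf{V}$ form a basis of neighbourhoods of the identity. "$\mathbf{V}$-closed" means closed in the pro-$\mathbf{V}$ topology, and $\mathrm{Cl}_{\mathbf{V}}(S)$ denotes the closure of $S \subseteq F$ in the pro-$\mathbf{V}$ topology on $F$. $C_m$ is the cyclic group of order $m$. For $w \in F \setminus\{1\}$, the exponent $\mathrm{exp}(w)$ is the maximum $r \geq 1$ such that $w = v^r$ for some $v \in F$, and $\mathrm{root}(w)$ is the (unique) element of $F$ with $w = \mathrm{root}(w)^{\mathrm{exp}(w)}$. *)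

theory Defs
  imports
    "HOL-Algebra.Elementary_Groups"
    "HOL-Algebra.Coset"
    "HOL-Analysis.Abstract_Topology"
    "HOL-Library.Nat_Bijection"
begin

section \<open>Pseudovarieties of finite groups\<close>

text \<open>
  A class of finite groups that is closed under isomorphism is determined by its members whose
  carrier consists of natural numbers, so it is represented by a set of such groups. A group over
  an arbitrary type belongs to the class if it is isomorphic to one of these members.
\<close>

definition in_class :: "('a, 'm) monoid_scheme \<Rightarrow> nat monoid set \<Rightarrow> bool" where
  "in_class G V \<longleftrightarrow> (\<exists>H\<in>V. G \<cong> H)"

text \<open>
  Closure under homomorphic images includes closure under isomorphism (within the type
  \<^typ>\<open>nat monoid\<close>). Finitary products are the binary ones together with the empty one.
\<close>

definition pseudovariety :: "nat monoid set \<Rightarrow> bool" where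
  "pseudovariety V \<longleftrightarrow>
     (\<forall>G\<in>V. group G \<and> finite (carrier G)) \<and>
     (\<forall>G\<in>V. \<forall>K. subgroup K G \<longrightarrow> G\<lparr>carrier := K\<rparr> \<in> V) \<and>
     (\<forall>G\<in>V. \<forall>H. group H \<and> epi G H \<noteq> {} \<longrightarrow> H \<in> V) \<and>
     (\<forall>G. trivial_group G \<longrightarrow> G \<in> V) \<and>
     (\<forall>G\<in>V. \<forall>H\<in>V. in_class (G \<times>\<times> H) V)"

definition nontrivial_class :: "nat monoid set \<Rightarrow> bool" where
  "nontrivial_class V \<longleftrightarrow> (\<exists>G\<in>V. \<not> trivial_group G)"

definition extension_closed :: "nat monoid set \<Rightarrow> bool" where
  "extension_closed V \<longleftrightarrow>
     (\<forall>G N. group G \<and> finite (carrier G) \<and> N \<lhd> G \<and>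
        in_class (G\<lparr>carrier := N\<rparr>) V \<and> in_class (G Mod N) V \<longrightarrow> G \<in> V)"

definition pro_topology :: "nat monoid set \<Rightarrow> ('a, 'm) monoid_scheme \<Rightarrow> 'a topology" where
  "pro_topology V G = topology_generated_by
     {{x \<in> carrier G. \<phi> x \<in> U} | \<phi> H U.
        H \<in> V \<and> \<phi> \<in> hom G H \<and> openin (discrete_topology (carrier H)) U}"

section \<open>Free groups\<close>

text \<open>
  A letter \<open>(i, True)\<close> stands for the generator \<open>i\<close>, and \<open>(i, False)\<close> for its formal inverse.
  The map \<open>x\<close> says which group elements the generators denote.
\<close>

definition word_eval ::
  "('a, 'm) monoid_scheme \<Rightarrow> ('i \<Rightarrow> 'a) \<Rightarrow> ('i \<times> bool) list \<Rightarrow> 'a" where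
  "word_eval G x p =
     foldr (\<lambda>(i, b) y. (if b then x i else inv\<^bsub>G\<^esub> x i) \<otimes>\<^bsub>G\<^esub> y) p \<one>\<^bsub>G\<^esub>"

definition words_over :: "'i set \<Rightarrow> ('i \<times> bool) list set" where
  "words_over I = lists (I \<times> UNIV)"

definition reduced :: "('i \<times> bool) list \<Rightarrow> bool" where
  "reduced p \<longleftrightarrow> successively (\<lambda>(i, b) (j, c). \<not> (i = j \<and> b \<noteq> c)) p"

text \<open>\<open>G\<close> is free on \<open>X\<close>: every element is the value of exactly one reduced word over \<open>X\<close>.\<close>

definition free_on :: "('a, 'm) monoid_scheme \<Rightarrow> 'a set \<Rightarrow> bool" where
  "free_on G X \<longleftrightarrow> group G \<and> X \<subseteq> carrier G \<and>
     bij_betw (word_eval G (\<lambda>a. a)) {p \<in> words_over X. reduced p} (carrier G)"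

definition grp_exp :: "('a, 'm) monoid_scheme \<Rightarrow> 'a \<Rightarrow> nat" where
  "grp_exp G w = Max {r. 1 \<le> r \<and> (\<exists>v\<in>carrier G. w = v [^]\<^bsub>G\<^esub> r)}"

definition grp_root :: "('a, 'm) monoid_scheme \<Rightarrow> 'a \<Rightarrow> 'a" where
  "grp_root G w = (THE u. u \<in> carrier G \<and> w = u [^]\<^bsub>G\<^esub> grp_exp G w)"

section \<open>Computability\<close>

text \<open>
  The (total) recursive functions: \<open>recursive_fun n f\<close> says that \<open>f\<close>, on argument lists of length
  \<open>n\<close>, is obtained from the initial functions by composition, primitive recursion and
  minimization of regular functions. Values on lists of any other length are irrelevant.
\<close>

inductive recursive_fun :: "nat \<Rightarrow> (nat list \<Rightarrow> nat) \<Rightarrow> bool" where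
  zero: "recursive_fun n (\<lambda>xs. 0)"
| succ: "recursive_fun 1 (\<lambda>xs. Suc (xs ! 0))"
| proj: "i < n \<Longrightarrow> recursive_fun n (\<lambda>xs. xs ! i)"
| comp: "recursive_fun (length gs) f \<Longrightarrow> \<forall>g\<in>set gs. recursive_fun n g \<Longrightarrow>
    recursive_fun n (\<lambda>xs. f (map (\<lambda>g. g xs) gs))"
| prim_rec: "recursive_fun n f \<Longrightarrow> recursive_fun (n + 2) g \<Longrightarrow>
    recursive_fun (n + 1)
      (\<lambda>xs. rec_nat (f (tl xs)) (\<lambda>k r. g (k # r # tl xs)) (hd xs))"
| minimize: "recursive_fun (n + 1) f \<Longrightarrow>
    \<forall>xs. length xs = n \<longrightarrow> (\<exists>y. f (y # xs) = 0) \<Longrightarrow>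
    recursive_fun n (\<lambda>xs. LEAST y. f (y # xs) = 0)"

definition decidable_set :: "nat set \<Rightarrow> bool" where
  "decidable_set A \<longleftrightarrow>
     (\<exists>f. recursive_fun 1 f \<and> (\<forall>n. f [n] = (if n \<in> A then 1 else 0)))"

definition word_code :: "(nat \<times> bool) list \<Rightarrow> nat" where
  "word_code p = list_encode (map (\<lambda>(i, b). 2 * i + of_bool b) p)"

definition computable_on_words ::
  "((nat \<times> bool) list \<Rightarrow> (nat \<times> bool) list) \<Rightarrow> bool" where
  "computable_on_words g \<longleftrightarrow>
     (\<exists>f. recursive_fun 1 f \<and> (\<forall>p. f [word_code p] = word_code (g p)))"

text \<open>
  One algorithm, given a word for \<open>w \<noteq> \<one>\<close>, returns a word for a generator of the closure of
  \<open>\<langle>w\<rangle>\<close>. As \<open>X\<close> may have any cardinality, words are written over numerical names: \<open>x\<close> injectively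
  assigns elements of the basis \<open>X\<close> to the names in \<open>I\<close>, and the answer uses only names in \<open>I\<close>.
  If \<open>X\<close> is countable, \<open>x\<close> can be an enumeration of all of \<open>X\<close>; in general, finitely many
  names suffice for any given \<open>w\<close>.
\<close>

definition closure_computable ::
  "nat monoid set \<Rightarrow> ('a, 'm) monoid_scheme \<Rightarrow> 'a set \<Rightarrow> bool" where
  "closure_computable V G X \<longleftrightarrow>
     (\<exists>g. computable_on_words g \<and>
        (\<forall>I x p. inj_on x I \<and> x ` I \<subseteq> X \<and> p \<in> words_over I \<and> word_eval G x p \<noteq> \<one>\<^bsub>G\<^esub> \<longrightarrow>
           g p \<in> words_over I \<and>
           pro_topology V G closure_of generate G {word_eval G x p} =
             generate G {word_eval G x (g p)}))"

end

theory Submission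
  imports Defs "HOL-Algebra.Product_Groups" "HOL-Algebra.Multiplicative_Group"
    "HOL-Computational_Algebra.Primes"
begin

text \<open>
  Two facts about the free group \<open>F\<close> carry the argument. First, if \<open>C\<^sub>p \<in> V\<close> for a prime
  \<open>p\<close>, then finite \<open>p\<close>-groups in \<open>V\<close> separate the elements of \<open>F\<close>: they are iterated wreath
  products with \<open>C\<^sub>p\<close>. Second, the centralizer of \<open>w \<noteq> 1\<close> is generated by \<open>u = root(w)\<close>, as
  one sees by comparing words in the free monoid.

  Since \<open>F\<close> is separated by \<open>V\<close>, the closure of \<open>\<langle>w\<rangle>\<close> centralizes \<open>w\<close>, hence lies in \<open>\<langle>u\<rangle>\<close>.
  Let \<open>m\<close> be the largest divisor of \<open>e = exp(w)\<close> with \<open>C\<^sub>m \<in> V\<close>; every other such divisor divides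
  \<open>m\<close>. If a prime power \<open>q\<^sup>j\<close> divides \<open>m\<close> but not \<open>k\<close>, then a \<open>q\<close>-group in \<open>V\<close> in which the image of
  \<open>u\<close> has order divisible by \<open>q\<^sup>j\<close> shows that \<open>u\<^sup>k\<close> is not in the closure. Conversely, the image
  of \<open>u\<close> in a member of \<open>V\<close> has an order \<open>n\<close> with \<open>C\<^sub>n \<in> V\<close>, so that \<open>gcd(e, n)\<close> divides \<open>m\<close> and
  the image of \<open>u\<^sup>m\<close> is a power of that of \<open>w\<close>.

  For the algorithm, the reduced word of \<open>w\<close> has the form \<open>c t\<^sup>e c\<^sup>-\<^sup>1\<close>, so that
  \<open>u\<^sup>m\<close> is obtained from it by cutting out a segment. Among the words \<open>q\<close> obtained in this way with
  \<open>q\<^sup>k = w\<close> for some \<open>k\<close> without divisors \<open>d \<ge> 2\<close> such that \<open>C\<^sub>d \<in> V\<close>, one with maximal \<open>k\<close>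
  represents \<open>u\<^sup>m\<close>.
\<close>

section \<open>Words and their evaluation in a group\<close>

definition flip :: "'i \<times> bool \<Rightarrow> 'i \<times> bool" where
  "flip l = (fst l, \<not> snd l)"

definition inv_word :: "('i \<times> bool) list \<Rightarrow> ('i \<times> bool) list" where
  "inv_word p = rev (map flip p)"

definition word_pow :: "nat \<Rightarrow> 'b list \<Rightarrow> 'b list" where
  "word_pow n p = concat (replicate n p)"

lemma flip_flip [simp]: "flip (flip l) = l"
  by (simp add: flip_def)

lemma fst_flip [simp]: "fst (flip l) = fst l"
  by (simp add: flip_def)

lemma flip_eq_iff: "flip l = m \<longleftrightarrow> l = flip m"
  by (auto simp: flip_def prod_eq_iff)

lemma flip_neq [simp]: "flip l \<noteq> l" "l \<noteq> flip l"
  by (auto simp: flip_def prod_eq_iff)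

lemma inv_word_simps [simp]:
  "inv_word [] = []" "inv_word (l # p) = inv_word p @ [flip l]"
  "inv_word (p @ q) = inv_word q @ inv_word p" "length (inv_word p) = length p"
  by (auto simp: inv_word_def)

lemma reduced_iff_flip: "reduced p \<longleftrightarrow> successively (\<lambda>l m. m \<noteq> flip l) p"
  unfolding reduced_def by (rule successively_cong) (auto simp: flip_def)

lemma reduced_Nil [simp]: "reduced []"
  by (simp add: reduced_def)

lemma reduced_append:
  "reduced (p @ q) \<longleftrightarrow> reduced p \<and> reduced q \<and> (p = [] \<or> q = [] \<or> hd q \<noteq> flip (last p))"
  by (auto simp: reduced_iff_flip successively_append_iff)

lemma reduced_Cons:
  "reduced (l # p) \<longleftrightarrow> reduced p \<and> (p = [] \<or> hd p \<noteq> flip l)"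
  by (auto simp: reduced_iff_flip successively_Cons)

lemma reduced_rev [simp]: "reduced (rev p) = reduced p"
  unfolding reduced_iff_flip successively_rev
  by (rule successively_cong) (auto simp: flip_eq_iff)

text \<open>All cancellation between two reduced words happens in one block \<open>c\<close>: as
  long as the last letter of \<open>p\<close> is inverse to the first letter of \<open>q\<close>,
  both are stripped; once they do not cancel, the concatenation is reduced.\<close>

lemma reduced_product:
  assumes "reduced p" "reduced q"
  shows "\<exists>a b c. p = a @ c \<and> q = inv_word c @ b \<and> reduced (a @ b)"
  using assms
proof (induction p arbitrary: q rule: rev_induct)
  case Nil
  then show ?case by auto
next
  case (snoc l p)
  show ?case
  proof (cases "q \<noteq> [] \<and> hd q = flip l")
    case True
    then obtain q' where q: "q = flip l # q'"
      by (cases q) auto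
    with snoc.prems have "reduced p" "reduced q'"
      by (auto simp: reduced_append reduced_Cons)
    from snoc.IH[OF this] obtain a b c where
      "p = a @ c" "q' = inv_word c @ b" "reduced (a @ b)" by blast
    then show ?thesis
      using q by (intro exI[of _ a] exI[of _ b] exI[of _ "c @ [l]"]) simp
  next
    case False
    then have "reduced ((p @ [l]) @ q)"
      using snoc.prems unfolding reduced_append[of "p @ [l]"] by auto
    then show ?thesis
      by (intro exI[of _ "p @ [l]"] exI[of _ q] exI[of _ "[]"]) simp
  qed
qed

text \<open>If \<open>w @ w\<close> is not reduced, the first and last letters of \<open>w\<close>
  are mutually inverse; they move into the conjugator \<open>c\<close>, and induction on the length
  treats the rest.\<close>

lemma cyclic_reduction:
  assumes "reduced w" "w \<noteq> []"
  shows "\<exists>c v. w = c @ v @ inv_word c \<and> v \<noteq> [] \<and> reduced (v @ v)"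
  using assms
proof (induction "length w" arbitrary: w rule: less_induct)
  case less
  show ?case
  proof (cases "reduced (w @ w)")
    case True
    then show ?thesis
      using less.prems by (intro exI[of _ "[]"] exI[of _ w]) simp
  next
    case False
    obtain l w1 where w: "w = l # w1"
      using less.prems by (cases w) auto
    have hl: "hd w = flip (last w)"
      using False less.prems by (simp add: reduced_append)
    have "w1 \<noteq> []"
      using hl w by auto
    then obtain w2 m where w1: "w1 = w2 @ [m]"
      by (cases w1 rule: rev_exhaust) auto
    have m: "m = flip l"
      using hl by (simp add: w w1 flip_eq_iff)
    have w': "w = l # w2 @ [flip l]"
      by (simp add: w w1 m)
    \<comment> \<open>Otherwise \<open>w\<close> would be \<open>[l, flip l]\<close>, which is not
      reduced.\<close>
    have "w2 \<noteq> []"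
      using less.prems w' by (auto simp: reduced_Cons)
    moreover have "reduced w2"
      using less.prems w' by (auto simp: reduced_Cons reduced_append)
    ultimately obtain c v where "w2 = c @ v @ inv_word c" "v \<noteq> []" "reduced (v @ v)"
      using less.hyps[of w2] w' by auto
    then show ?thesis
      using w' by (intro exI[of _ "l # c"] exI[of _ v]) simp
  qed
qed

section \<open>Powers and commuting words in the free monoid\<close>

lemma word_pow_0 [simp]: "word_pow 0 p = []"
  by (simp add: word_pow_def)

lemma word_pow_Suc [simp]: "word_pow (Suc n) p = p @ word_pow n p"
  by (simp add: word_pow_def)

lemma word_pow_add: "word_pow (m + n) p = word_pow m p @ word_pow n p"
  by (induction m) auto

lemma word_pow_Nil [simp]: "word_pow n [] = []"
  by (simp add: word_pow_def)

lemma word_pow_Suc': "word_pow (Suc n) p = word_pow n p @ p"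
  using word_pow_add[of n 1 p] by simp

lemma length_word_pow [simp]: "length (word_pow n p) = n * length p"
  by (induction n) auto

lemma word_pow_mult: "word_pow m (word_pow n p) = word_pow (m * n) p"
  by (induction m) (auto simp: word_pow_add)

lemma word_pow_comm: "word_pow m p @ word_pow n p = word_pow n p @ word_pow m p"
  by (simp flip: word_pow_add add: add.commute)

lemma word_pow_nonempty: "n > 0 \<Longrightarrow> p \<noteq> [] \<Longrightarrow> word_pow n p \<noteq> []"
  by (cases n) auto

lemma hd_word_pow: "n > 0 \<Longrightarrow> p \<noteq> [] \<Longrightarrow> hd (word_pow n p) = hd p"
  by (cases n) auto

lemma reduced_word_pow:
  assumes "reduced (v @ v)"
  shows "reduced (word_pow n v)"
proof (induction n)
  case (Suc n)
  then show ?case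
    using assms
    by (cases "n = 0") (auto simp: reduced_append hd_word_pow)
qed simp

lemma append_comm_word_pow:
  assumes "y @ w = w @ y"
  shows "y @ word_pow n w = word_pow n w @ y"
proof (induction n)
  case (Suc n)
  have "y @ word_pow (Suc n) w = w @ y @ word_pow n w"
    using assms by simp
  then show ?case
    by (simp add: Suc)
qed simp

text \<open>Both products are prefixes of the same length of a large power of \<open>w\<close>.\<close>

lemma append_comm_trans:
  assumes "y @ w = w @ y" "z @ w = w @ z" "w \<noteq> []"
  shows "y @ z = z @ y"
proof -
  define n where "n = length (y @ z)"
  have len: "length (y @ z) \<le> length (word_pow n w)"
    using \<open>w \<noteq> []\<close> by (cases w) (auto simp: n_def)
  have pre: "x = take (length x) (word_pow n w)"
    if "x @ w = w @ x" "length x = length (y @ z)" for x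
  proof -
    have "take (length x) (x @ word_pow n w) = take (length x) (word_pow n w @ x)"
      using append_comm_word_pow[OF that(1)] by simp
    then show ?thesis
      using len that(2) by simp
  qed
  have "(y @ z) @ w = w @ (y @ z)"
    using assms by (metis append_assoc)
  moreover have "(z @ y) @ w = w @ (z @ y)"
    using assms by (metis append_assoc)
  ultimately show ?thesis
    using pre[of "y @ z"] pre[of "z @ y"] by (metis add.commute length_append)
qed

lemma append_comm_common_power:
  assumes "x @ y = y @ x"
  shows "\<exists>s m n. x = word_pow m s \<and> y = word_pow n s"
  using comm_append_are_replicate[OF assms] unfolding word_pow_def by metis

text \<open>Take \<open>t\<close> shortest among the words of which \<open>v\<close> is a power. If
  \<open>y\<close> commutes with \<open>v\<close>, it also commutes with \<open>t\<close>, so both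
  are powers of a common word \<open>s\<close>. Then \<open>v\<close> is a power of \<open>s\<close>
  as well, and minimality forces \<open>t = s\<close>.\<close>

lemma primitive_root_word:
  assumes "v \<noteq> []"
  shows "\<exists>t r. r > 0 \<and> v = word_pow r t \<and> (\<forall>y. y @ v = v @ y \<longrightarrow> (\<exists>a. y = word_pow a t))"
proof -
  define P where "P t \<longleftrightarrow> (\<exists>r. v = word_pow r t)" for t
  have "P v"
    unfolding P_def by (intro exI[of _ 1]) simp
  then obtain t where t: "P t" and min: "\<And>s. P s \<Longrightarrow> length t \<le> length s"
    using ex_has_least_nat[of P v length] by auto
  from t obtain r where r: "v = word_pow r t"
    by (auto simp: P_def)
  have r0: "r > 0" and t0: "t \<noteq> []"
    using assms r by (auto simp: word_pow_def intro: Nat.gr0I)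
  have tv: "t @ v = v @ t"
    unfolding r using word_pow_comm[of 1 t r] by simp
  have "\<exists>a. y = word_pow a t" if yv: "y @ v = v @ y" for y
  proof -
    obtain s m n where s: "y = word_pow m s" "t = word_pow n s"
      using append_comm_common_power[OF append_comm_trans[OF yv tv assms]] by blast
    have "P s"
      unfolding P_def r s(2) word_pow_mult by blast
    then have "length t \<le> length s"
      by (rule min)
    moreover have "s \<noteq> []" "n \<noteq> 0"
      using s(2) t0 by (auto intro: Nat.gr0I)
    ultimately have "n \<le> 1" "n \<noteq> 0"
      using s(2) by auto
    then have "n = 1"
      by simp
    then show ?thesis
      using s by auto
  qed
  then show ?thesis
    using r r0 by blast
qed

lemma words_over_simps [simp]:
  "[] \<in> words_over I" "l # p \<in> words_over I \<longleftrightarrow> fst l \<in> I \<and> p \<in> words_over I"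
  "p @ q \<in> words_over I \<longleftrightarrow> p \<in> words_over I \<and> q \<in> words_over I"
  "rev p \<in> words_over I \<longleftrightarrow> p \<in> words_over I"
  "inv_word p \<in> words_over I \<longleftrightarrow> p \<in> words_over I"
  by (auto simp: words_over_def inv_word_def in_lists_conv_set mem_Times_iff)

lemma words_over_take_drop:
  "p \<in> words_over I \<Longrightarrow> take n p \<in> words_over I" "p \<in> words_over I \<Longrightarrow> drop n p \<in> words_over I"
  by (auto simp: words_over_def in_lists_conv_set dest: in_set_takeD in_set_dropD)

lemma words_over_word_pow: "p \<in> words_over I \<Longrightarrow> word_pow n p \<in> words_over I"
  by (induction n) auto

section \<open>Free reduction by means of a stack of letters\<close>

fun push :: "'i \<times> bool \<Rightarrow> ('i \<times> bool) list \<Rightarrow> ('i \<times> bool) list" where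
  "push l [] = [l]"
| "push l (m # s) = (if m = flip l then s else l # m # s)"

text \<open>The result is a stack: it is the reduced form of \<open>p\<close>, read backwards.\<close>

definition reduce_rev :: "('i \<times> bool) list \<Rightarrow> ('i \<times> bool) list" where
  "reduce_rev p = fold push p []"

text \<open>In the cancelling case the old stack is \<open>flip l\<close> on top of the new one. In
  this form the effect of \<open>push\<close> on values can be computed without inspecting the
  stack.\<close>

lemma push_cases: "push l s = l # s \<or> s = flip l # push l s"
  by (cases s) auto

lemma push_reduced: "reduced s \<Longrightarrow> reduced (push l s)"
  by (cases s) (auto simp: reduced_Cons)

lemma push_words_over: "fst l \<in> I \<Longrightarrow> s \<in> words_over I \<Longrightarrow> push l s \<in> words_over I"
  by (cases s) auto

lemma fold_push_reduced: "reduced s \<Longrightarrow> reduced (fold push p s)"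
  by (induction p arbitrary: s) (auto simp: push_reduced)

lemma fold_push_words_over:
  "p \<in> words_over I \<Longrightarrow> s \<in> words_over I \<Longrightarrow> fold push p s \<in> words_over I"
  by (induction p arbitrary: s) (auto simp: push_words_over)

lemma fold_push_append: "reduced (rev s @ p) \<Longrightarrow> fold push p s = rev p @ s"
proof (induction p arbitrary: s)
  case (Cons l p)
  have "push l s = l # s"
    using Cons.prems by (cases s) (auto simp: reduced_append reduced_Cons)
  then show ?case
    using Cons.prems Cons.IH[of "l # s"] by simp
qed simp

lemma reduce_rev_reduced: "reduced p \<Longrightarrow> reduce_rev p = rev p"
  using fold_push_append[of "[]" p] by (simp add: reduce_rev_def)

section \<open>Evaluation of words in a group\<close>

definition letter :: "('a, 'm) monoid_scheme \<Rightarrow> ('i \<Rightarrow> 'a) \<Rightarrow> 'i \<times> bool \<Rightarrow> 'a" where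
  "letter G x l = (if snd l then x (fst l) else inv\<^bsub>G\<^esub> x (fst l))"

lemma word_eval_Nil [simp]: "word_eval G x [] = \<one>\<^bsub>G\<^esub>"
  by (simp add: word_eval_def)

lemma word_eval_Cons [simp]: "word_eval G x (l # p) = letter G x l \<otimes>\<^bsub>G\<^esub> word_eval G x p"
  by (simp add: word_eval_def letter_def split: prod.split)

lemma word_eval_map: "word_eval G (\<lambda>a. a) (map (map_prod x id) p) = word_eval G x p"
  by (induction p) (auto simp: letter_def)

context group
begin

lemma letter_closed: "x \<in> I \<rightarrow> carrier G \<Longrightarrow> fst l \<in> I \<Longrightarrow> letter G x l \<in> carrier G"
  by (auto simp: letter_def Pi_iff)

lemma letter_flip: "x \<in> I \<rightarrow> carrier G \<Longrightarrow> fst l \<in> I \<Longrightarrow> letter G x (flip l) = inv letter G x l"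
  by (auto simp: letter_def flip_def Pi_iff)

lemma word_eval_closed:
  "x \<in> I \<rightarrow> carrier G \<Longrightarrow> p \<in> words_over I \<Longrightarrow> word_eval G x p \<in> carrier G"
  by (induction p) (auto simp: letter_closed)

lemma word_eval_append:
  "x \<in> I \<rightarrow> carrier G \<Longrightarrow> p \<in> words_over I \<Longrightarrow> q \<in> words_over I \<Longrightarrow>
    word_eval G x (p @ q) = word_eval G x p \<otimes> word_eval G x q"
  by (induction p) (auto simp: letter_closed word_eval_closed m_assoc)

lemma word_eval_inv_word:
  assumes "x \<in> I \<rightarrow> carrier G" "p \<in> words_over I"
  shows "word_eval G x (inv_word p) = inv word_eval G x p"
  using assms(2)
proof (induction p)
  case (Cons l p)
  then have "letter G x l \<in> carrier G" "word_eval G x p \<in> carrier G"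
    using assms(1) by (auto simp: letter_closed word_eval_closed)
  then show ?case
    using Cons assms(1)
    by (simp add: word_eval_append[OF assms(1)] letter_flip[OF assms(1)] inv_mult_group)
qed simp

lemma word_eval_word_pow:
  assumes "x \<in> I \<rightarrow> carrier G" "p \<in> words_over I"
  shows "word_eval G x (word_pow n p) = word_eval G x p [^] n"
proof (induction n)
  case (Suc n)
  show ?case
    unfolding word_pow_Suc' using assms Suc
    by (simp add: word_eval_append[OF assms(1)] words_over_word_pow)
qed simp

lemma word_eval_push:
  assumes "x \<in> I \<rightarrow> carrier G" "fst l \<in> I" "s \<in> words_over I"
  shows "word_eval G x (rev (push l s)) = word_eval G x (rev s) \<otimes> letter G x l"
  using push_cases[of l s]
proof
  assume "push l s = l # s"
  then show ?thesis
    using assms by (simp add: word_eval_append[OF assms(1)] letter_closed)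
next
  assume s: "s = flip l # push l s"
  define s' where "s' = push l s"
  have s2: "s = flip l # s'"
    using s by (simp add: s'_def)
  then have "s' \<in> words_over I"
    using assms(3) by simp
  then have "word_eval G x (rev s) \<otimes> letter G x l = word_eval G x (rev s')"
    using assms(1,2) unfolding s2
    by (simp add: word_eval_append[OF assms(1)] letter_closed letter_flip word_eval_closed m_assoc)
  then show ?thesis
    by (simp add: s'_def)
qed

lemma word_eval_fold_push:
  assumes "x \<in> I \<rightarrow> carrier G"
  shows "p \<in> words_over I \<Longrightarrow> s \<in> words_over I \<Longrightarrow>
    word_eval G x (rev (fold push p s)) = word_eval G x (rev s) \<otimes> word_eval G x p"
proof (induction p arbitrary: s)
  case (Cons l p)
  then show ?case
    using assms
    by (simp add: push_words_over word_eval_push[OF assms] letter_closed word_eval_closed m_assoc)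
qed (simp add: word_eval_closed[OF assms])

lemma word_eval_reduce_rev:
  assumes "x \<in> I \<rightarrow> carrier G" "p \<in> words_over I"
  shows "word_eval G x (rev (reduce_rev p)) = word_eval G x p"
  using word_eval_fold_push[OF assms, of "[]"] assms by (simp add: reduce_rev_def word_eval_closed)

lemma word_eval_reduced_product:
  assumes "x \<in> I \<rightarrow> carrier G" "a \<in> words_over I" "b \<in> words_over I" "c \<in> words_over I"
  shows "word_eval G x (a @ c) \<otimes> word_eval G x (inv_word c @ b) = word_eval G x (a @ b)"
proof -
  have "word_eval G x c \<otimes> (inv word_eval G x c \<otimes> word_eval G x b) = word_eval G x b"
    using assms by (simp add: word_eval_closed flip: m_assoc)
  then show ?thesis
    using assms
    by (simp add: word_eval_append[OF assms(1)] word_eval_inv_word[OF assms(1)] word_eval_closed m_assoc)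
qed

end

lemma word_eval_hom:
  assumes "group G" "group H" "h \<in> hom G H" "x \<in> I \<rightarrow> carrier G"
  shows "p \<in> words_over I \<Longrightarrow> h (word_eval G x p) = word_eval H (h \<circ> x) p"
proof (induction p)
  case Nil
  interpret group_hom G H h
    using assms by (simp add: group_hom_def group_hom_axioms_def)
  show ?case by simp
next
  case (Cons l p)
  interpret group_hom G H h
    using assms by (simp add: group_hom_def group_hom_axioms_def)
  have "x (fst l) \<in> carrier G"
    using Cons.prems assms(4) by auto
  then have "h (letter G x l) = letter H (h \<circ> x) l"
    by (simp add: letter_def)
  then show ?case
    using Cons assms(4) by (simp add: G.letter_closed G.word_eval_closed del: o_apply comp_apply)
qed

section \<open>Centralizers and roots in free groups\<close>

locale free_group =
  fixes F :: "('a, 'm) monoid_scheme" (structure) and X :: "'a set"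
  assumes free: "free_on F X"
begin

sublocale group F
  using free by (simp add: free_on_def)

abbreviation eval :: "('a \<times> bool) list \<Rightarrow> 'a" where
  "eval \<equiv> word_eval F (\<lambda>a. a)"

lemma basis: "(\<lambda>a. a) \<in> X \<rightarrow> carrier F"
  using free by (auto simp: free_on_def)

lemmas eval_closed [simp] = word_eval_closed[OF basis]
  and eval_append = word_eval_append[OF basis]
  and eval_inv_word = word_eval_inv_word[OF basis]
  and eval_word_pow = word_eval_word_pow[OF basis]
  and eval_reduced_product = word_eval_reduced_product[OF basis]

lemma reduced_word_exists:
  assumes "g \<in> carrier F"
  obtains p where "p \<in> words_over X" "reduced p" "eval p = g"
proof -
  have "g \<in> eval ` {p \<in> words_over X. reduced p}"
    using free assms by (simp add: free_on_def bij_betw_def)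
  then show thesis
    using that by auto
qed

lemma reduced_word_unique:
  assumes "eval p = eval q" "p \<in> words_over X" "reduced p" "q \<in> words_over X" "reduced q"
  shows "p = q"
  using free assms unfolding free_on_def bij_betw_def inj_on_def by blast

text \<open>The universal property of free groups: an element is sent to the value in
  \<open>H\<close> of its reduced word. By \<open>reduced_product\<close>, two factors have reduced
  words \<open>a @ c\<close> and \<open>inv_word c @ b\<close>, and their product has
  \<open>a @ b\<close>; the block \<open>c\<close> cancels in \<open>H\<close> just as in
  \<open>F\<close>.\<close>

lemma extend_hom:
  fixes H :: "('b, 'n) monoid_scheme"
  assumes "group H" "f \<in> X \<rightarrow> carrier H"
  shows "\<exists>\<phi>\<in>hom F H. \<forall>p. p \<in> words_over X \<longrightarrow> reduced p \<longrightarrow> \<phi> (eval p) = word_eval H f p"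
proof -
  interpret H: group H by fact
  define nf where "nf g = (SOME p. p \<in> words_over X \<and> reduced p \<and> eval p = g)" for g
  have nf: "nf g \<in> words_over X" "reduced (nf g)" "eval (nf g) = g" if "g \<in> carrier F" for g
    using someI_ex[of "\<lambda>p. p \<in> words_over X \<and> reduced p \<and> eval p = g"] reduced_word_exists[OF that]
    unfolding nf_def by metis+
  have nf_eval: "nf (eval p) = p" if "p \<in> words_over X" "reduced p" for p
    using that nf[of "eval p"] by (intro reduced_word_unique) auto
  define \<phi> where "\<phi> g = word_eval H f (nf g)" for g
  have "\<phi> \<in> hom F H"
  proof (rule homI)
    show "\<phi> g \<in> carrier H" if "g \<in> carrier F" for g
      using nf[OF that] H.word_eval_closed[OF assms(2)] by (simp add: \<phi>_def)
    show "\<phi> (g \<otimes> h) = \<phi> g \<otimes>\<^bsub>H\<^esub> \<phi> h" if "g \<in> carrier F" "h \<in> carrier F" for g h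
    proof -
      obtain a b c where abc: "nf g = a @ c" "nf h = inv_word c @ b" "reduced (a @ b)"
        using reduced_product[OF nf(2) nf(2)] \<open>g \<in> carrier F\<close> \<open>h \<in> carrier F\<close> by blast
      have ov: "a \<in> words_over X" "b \<in> words_over X" "c \<in> words_over X"
        using nf(1)[OF \<open>g \<in> carrier F\<close>] nf(1)[OF \<open>h \<in> carrier F\<close>] abc by auto
      have "g \<otimes> h = eval (a @ b)"
        using eval_reduced_product[OF ov] nf(3)[OF that(1)] nf(3)[OF that(2)] abc by metis
      then have "nf (g \<otimes> h) = a @ b"
        using nf_eval ov abc by simp
      then show ?thesis
        unfolding \<phi>_def abc by (simp add: H.word_eval_reduced_product[OF assms(2) ov])
    qed
  qed
  moreover have "\<phi> (eval p) = word_eval H f p" if "p \<in> words_over X" "reduced p" for p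
    using nf_eval[OF that] by (simp add: \<phi>_def)
  ultimately show ?thesis by blast
qed

text \<open>
  For large \<open>n\<close>, the element \<open>x\<close> commutes with \<open>v\<close> iff the reduced word of \<open>x \<otimes> v [^] n\<close> does so
  in the free monoid, since this word begins and ends with \<open>v\<close>.
\<close>

lemma commutes_cyclically_reduced:
  assumes v: "v \<in> words_over X" "v \<noteq> []" "reduced (v @ v)"
    and t: "v = word_pow r t" "\<And>y. y @ v = v @ y \<Longrightarrow> \<exists>a. y = word_pow a t" "t \<in> words_over X"
    and x: "x \<in> carrier F" "x \<otimes> eval v = eval v \<otimes> x"
  shows "\<exists>k::int. x = eval t [^] k"
proof -
  obtain p where p: "p \<in> words_over X" "reduced p" "eval p = x"
    using reduced_word_exists[OF x(1)] .
  \<comment> \<open>Multiplication by \<open>x\<close> cancels at most \<open>length p\<close>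
    letters of this power, so at least \<open>length v\<close> letters survive at its far
    end.\<close>
  define n where "n = Suc (length p)"
  have vn: "word_pow n v \<in> words_over X" "reduced (word_pow n v)"
    using v by (auto simp: words_over_word_pow reduced_word_pow)
  have lenv: "length (word_pow n v) \<ge> length p + length v"
    using \<open>v \<noteq> []\<close> by (cases v) (auto simp: n_def)
  have xvn: "x \<otimes> eval (word_pow n v) = eval (word_pow n v) \<otimes> x"
    using x v by (simp add: eval_word_pow) (metis eval_closed group_commutes_pow)
  obtain a b c where abc: "p = a @ c" "word_pow n v = inv_word c @ b" "reduced (a @ b)"
    using reduced_product[OF p(2) vn(2)] by blast
  have ov: "a \<in> words_over X" "b \<in> words_over X" "c \<in> words_over X"
    using p(1) vn(1) abc by auto
  \<comment> \<open>The same element is also written with the power on the left, which exhibits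
    \<open>v\<close> as a prefix of its reduced word.\<close>
  obtain a' b' c' where abc': "word_pow n v = a' @ c'" "p = inv_word c' @ b'" "reduced (a' @ b')"
    using reduced_product[OF vn(2) p(2)] by blast
  have ov': "a' \<in> words_over X" "b' \<in> words_over X" "c' \<in> words_over X"
    using p(1) vn(1) abc' by auto
  define y where "y = a @ b"
  have y: "y \<in> words_over X" "reduced y"
    using ov abc by (auto simp: y_def)
  have eval_y: "eval y = x \<otimes> eval (word_pow n v)"
    using eval_reduced_product[OF ov] abc p by (simp add: y_def)
  moreover have "eval (a' @ b') = eval (word_pow n v) \<otimes> x"
    using eval_reduced_product[OF ov'] abc' p by simp
  ultimately have y': "y = a' @ b'"
    using y ov' abc' xvn by (intro reduced_word_unique) auto
  have "word_pow (length p) v @ v = inv_word c @ b"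
    using abc(2) by (simp only: n_def word_pow_Suc')
  moreover have "length b \<ge> length v"
  proof -
    have "length (inv_word c) + length b = length (word_pow n v)" "length c \<le> length p"
      using abc by (metis length_append) (simp add: abc)
    then show ?thesis using lenv by simp
  qed
  ultimately have "\<exists>b2. b = b2 @ v"
    unfolding append_eq_append_conv2 by auto
  then obtain b2 where b2: "b = b2 @ v" ..
  have "v @ word_pow (length p) v = a' @ c'"
    using abc'(1) by (simp only: n_def word_pow_Suc)
  moreover have "length a' \<ge> length v"
  proof -
    have "length a' + length c' = length (word_pow n v)" "length c' \<le> length p"
      using abc' by (metis length_append) (simp add: abc')
    then show ?thesis using lenv by simp
  qed
  ultimately obtain a2 where a2: "a' = v @ a2"
    by (metis append_eq_append_conv_if append_take_drop_id)
  \<comment> \<open>Since \<open>v @ v\<close> is reduced, nothing cancels in \<open>y @ v\<close>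
    or in \<open>v @ y\<close>; equality in the group thus becomes equality of words.\<close>
  have "last y = last v" "hd y = hd v"
    using v(2) b2 by (simp add: y_def) (simp add: y' a2 v(2))
  then have "reduced (y @ v)" "reduced (v @ y)"
    using y(2) v(2,3) by (simp_all add: reduced_append)
  moreover have "eval (y @ v) = eval (v @ y)"
  proof -
    have "eval (word_pow n v) \<otimes> eval v = eval v \<otimes> eval (word_pow n v)"
      using v by (simp add: eval_word_pow flip: nat_pow_Suc2)
    then have "x \<otimes> eval (word_pow n v) \<otimes> eval v = x \<otimes> eval v \<otimes> eval (word_pow n v)"
      using x(1) v vn by (simp add: m_assoc)
    also have "\<dots> = eval v \<otimes> x \<otimes> eval (word_pow n v)"
      using x(2) by simp
    also have "\<dots> = eval v \<otimes> (x \<otimes> eval (word_pow n v))"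
      using x(1) v vn by (simp add: m_assoc)
    finally show ?thesis
      using y v by (simp add: eval_append eval_y)
  qed
  ultimately have "y @ v = v @ y"
    using y v by (intro reduced_word_unique) auto
  then obtain k where k: "y = word_pow k t"
    using t(2) by blast
  have et: "eval t \<in> carrier F"
    using t(3) by simp
  have "x \<otimes> eval t [^] (n * r) = eval t [^] k"
    using eval_y k t by (simp add: eval_word_pow word_pow_mult)
  then have "x = eval t [^] k \<otimes> inv (eval t [^] (n * r))"
    using et x(1) by (metis inv_solve_right nat_pow_closed)
  then have "x = eval t [^] (int k - int (n * r))"
    using et by (simp add: int_pow_diff int_pow_int del: of_nat_mult)
  then show ?thesis ..
qed

text \<open>Here \<open>c\<close> is the conjugator in the cyclic reduction of \<open>W\<close> and
  \<open>t\<close> is the primitive root of the core. Conjugation by \<open>eval c\<close> carries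
  the facts about \<open>eval t\<close> over to \<open>eval (c @ t @ inv_word c)\<close>, the future
  root of \<open>eval W\<close>.\<close>

lemma root_word:
  assumes W: "W \<in> words_over X" "reduced W" "W \<noteq> []"
  obtains c t r where "W = c @ word_pow r t @ inv_word c" "r > 0"
    "\<And>n. eval (c @ word_pow n t @ inv_word c) = eval (c @ t @ inv_word c) [^] n"
    "\<And>x. x \<in> carrier F \<Longrightarrow> x \<otimes> eval W = eval W \<otimes> x \<Longrightarrow>
      \<exists>k::int. x = eval (c @ t @ inv_word c) [^] k"
    "\<And>n::nat. eval (c @ t @ inv_word c) [^] n = \<one> \<Longrightarrow> n = 0"
proof -
  obtain c v where cv: "W = c @ v @ inv_word c" "v \<noteq> []" "reduced (v @ v)"
    using cyclic_reduction[OF W(2,3)] by blast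
  obtain t r where tr: "r > 0" "v = word_pow r t" "\<And>y. y @ v = v @ y \<Longrightarrow> \<exists>a. y = word_pow a t"
    using primitive_root_word[OF cv(2)] by blast
  have c: "c \<in> words_over X" and v: "v \<in> words_over X"
    using W(1) cv(1) by auto
  obtain r' where r': "r = Suc r'"
    using tr(1) by (cases r) auto
  have t: "t \<in> words_over X"
    using v tr(2) r' by simp
  \<comment> \<open>As \<open>r > 0\<close>, the word \<open>t @ t\<close> is a prefix of
    \<open>v @ v = word_pow (2 * r) t\<close>.\<close>
  have tt: "reduced (t @ t)"
  proof -
    have "word_pow (2 * r) t = t @ t @ word_pow (2 * r') t"
      by (simp add: r' numeral_2_eq_2)
    moreover have "v @ v = word_pow (2 * r) t"
      by (simp add: tr(2) mult_2 word_pow_add)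
    ultimately show ?thesis
      using cv(3) by (metis append_assoc reduced_append)
  qed
  define g where "g = eval c"
  have g: "g \<in> carrier F" "eval t \<in> carrier F"
    using c t by (auto simp: g_def)
  define u where "u = eval (c @ t @ inv_word c)"
  have u: "u = g \<otimes> eval t \<otimes> inv g"
    using c t by (simp add: u_def g_def eval_append eval_inv_word m_assoc)
  have cn: "eval (c @ word_pow n t @ inv_word c) = g \<otimes> eval t [^] n \<otimes> inv g" for n
    using c t by (simp add: g_def eval_append eval_inv_word eval_word_pow m_assoc words_over_word_pow)
  have conj_mult: "(g \<otimes> a \<otimes> inv g) \<otimes> (g \<otimes> b \<otimes> inv g) = g \<otimes> (a \<otimes> b) \<otimes> inv g"
    if "a \<in> carrier F" "b \<in> carrier F" for a b
  proof -
    have "inv g \<otimes> (g \<otimes> (b \<otimes> inv g)) = b \<otimes> inv g"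
      using g that by (simp flip: m_assoc)
    then show ?thesis
      using g that by (simp add: m_assoc)
  qed
  have conj_pow: "g \<otimes> eval t [^] n \<otimes> inv g = u [^] n" for n :: nat
  proof (induction n)
    case (Suc n)
    have "g \<otimes> eval t [^] Suc n \<otimes> inv g = (g \<otimes> eval t [^] n \<otimes> inv g) \<otimes> (g \<otimes> eval t \<otimes> inv g)"
      using g by (simp add: conj_mult)
    then show ?case
      unfolding Suc by (simp add: u)
  qed (use g in simp)
  have conj_int_pow: "g \<otimes> eval t [^] k \<otimes> inv g = u [^] k" for k :: int
  proof (cases k)
    case (nonneg n)
    then show ?thesis using conj_pow by (simp add: int_pow_int)
  next
    case (neg n)
    have "u [^] k = inv (g \<otimes> eval t [^] Suc n \<otimes> inv g)"
      unfolding conj_pow neg using g by (intro int_pow_neg_int) (simp add: u)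
    also have "\<dots> = g \<otimes> eval t [^] k \<otimes> inv g"
      unfolding neg int_pow_neg_int[OF g(2)] using g by (simp add: inv_mult_group m_assoc del: nat_pow_Suc)
    finally show ?thesis by simp
  qed
  show thesis
  proof (rule that[of c r t])
    show "W = c @ word_pow r t @ inv_word c"
      using cv tr by simp
    show "eval (c @ word_pow n t @ inv_word c) = eval (c @ t @ inv_word c) [^] n" for n
      unfolding u_def[symmetric] cn conj_pow ..
    show "n = 0" if "eval (c @ t @ inv_word c) [^] n = \<one>" for n :: nat
    proof -
      have "g \<otimes> eval t [^] n \<otimes> inv g = \<one>"
        using that conj_pow by (simp add: u_def)
      then have "g \<otimes> eval t [^] n = g"
        using g inv_solve_right[of \<one> "g \<otimes> eval t [^] n" g] by simp
      then have "eval t [^] n = \<one>"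
        using g by simp
      \<comment> \<open>All powers of \<open>t\<close> are reduced, so one with value
        \<open>\<one>\<close> must be empty.\<close>
      then have "eval (word_pow n t) = eval []"
        using t by (simp add: eval_word_pow)
      then have "word_pow n t = []"
        using t tt by (intro reduced_word_unique) (auto simp: words_over_word_pow reduced_word_pow)
      then show ?thesis
        using cv(2) tr(2) word_pow_nonempty[of n t] by (cases "n = 0"; cases "t = []") auto
    qed
    show "\<exists>k::int. x = eval (c @ t @ inv_word c) [^] k"
      if x: "x \<in> carrier F" "x \<otimes> eval W = eval W \<otimes> x" for x
    proof -
      \<comment> \<open>Conjugated back, \<open>y\<close> commutes with the cyclically reduced core
        \<open>eval v\<close>.\<close>
      define y where "y = inv g \<otimes> x \<otimes> g"
      have xy: "x = g \<otimes> y \<otimes> inv g"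
      proof -
        have "g \<otimes> y \<otimes> inv g = (g \<otimes> inv g) \<otimes> x \<otimes> (g \<otimes> inv g)"
          using g x(1) unfolding y_def by (simp only: m_assoc inv_closed m_closed)
        then show ?thesis using g x(1) by simp
      qed
      have y: "y \<in> carrier F"
        using g x by (simp add: y_def)
      have W': "eval W = g \<otimes> eval v \<otimes> inv g"
        using c v by (simp add: cv(1) g_def eval_append eval_inv_word m_assoc)
      have "g \<otimes> (y \<otimes> eval v) \<otimes> inv g = g \<otimes> (eval v \<otimes> y) \<otimes> inv g"
        using x(2) v y unfolding W' xy by (simp add: conj_mult)
      then have "y \<otimes> eval v = eval v \<otimes> y"
        using g v y by simp
      then obtain k :: int where "y = eval t [^] k"
        using commutes_cyclically_reduced[OF v cv(2,3) tr(2,3) t y] by blast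
      then have "x = u [^] k"
        using xy conj_int_pow by simp
      then show ?thesis unfolding u_def ..
    qed
  qed (use tr in auto)
qed

text \<open>If \<open>v [^] n = w\<close>, then \<open>v\<close> commutes with \<open>w\<close> and
  is some \<open>u [^] k\<close>; as \<open>u\<close> has infinite order, \<open>r = k * n\<close>.
  So \<open>n\<close> divides \<open>r\<close>, which gives the maximum, and \<open>n = r\<close>
  forces \<open>k = 1\<close>, which gives uniqueness of the root.\<close>

lemma grp_exp_grp_root_eqI:
  assumes u: "u \<in> carrier F" "r > 0" "w = u [^] r"
    and centralizer: "\<And>x. x \<in> carrier F \<Longrightarrow> x \<otimes> w = w \<otimes> x \<Longrightarrow> \<exists>k::int. x = u [^] k"
    and order: "\<And>n::nat. u [^] n = \<one> \<Longrightarrow> n = 0"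
  shows "grp_exp F w = r" "grp_root F w = u"
proof -
  have order_int: "k = 0" if "u [^] k = \<one>" for k :: int
  proof (cases k)
    case (nonneg n)
    then show ?thesis
      using that order[of n] by (simp add: int_pow_int)
  next
    case (neg n)
    have "inv (u [^] Suc n) = \<one>"
      using that u(1) unfolding neg by (simp only: int_pow_neg_int)
    then have "u [^] Suc n = \<one>"
      using u(1) by (metis inv_eq_1_iff nat_pow_closed)
    then show ?thesis
      using order by blast
  qed
  have inj: "k = l" if "u [^] k = u [^] l" for k l :: int
    using that u(1) order_int[of "k - l"] by (simp add: int_pow_diff)
  have pow: "\<exists>k. v = u [^] k \<and> int r = k * int n"
    if v: "v \<in> carrier F" "w = v [^] n" for v and n :: nat
  proof -
    have "v \<otimes> w = w \<otimes> v"
      using v by (simp flip: nat_pow_Suc2)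
    then obtain k :: int where k: "v = u [^] k"
      using centralizer v by blast
    have "u [^] int r = u [^] (k * int n)"
      using v(2) u k int_pow_pow[OF u(1), of k "int n"] by (simp add: int_pow_int)
    then show ?thesis
      using inj k by blast
  qed
  have dvd: "n \<le> r" if "n \<ge> 1" "\<exists>v\<in>carrier F. w = v [^] n" for n :: nat
  proof -
    from \<open>\<exists>v\<in>carrier F. w = v [^] n\<close> obtain v where v: "v \<in> carrier F" "w = v [^] n" ..
    from pow[OF v] obtain k where "v = u [^] k \<and> int r = k * int n" ..
    then have "int n dvd int r"
      by simp
    then show ?thesis
      using u(2) by (auto dest: dvd_imp_le)
  qed
  show e: "grp_exp F w = r"
    unfolding grp_exp_def
  proof (rule Max_eqI)
    show "finite {n::nat. 1 \<le> n \<and> (\<exists>v\<in>carrier F. w = v [^] n)}"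
      by (rule finite_subset[OF _ finite_atMost[of r]]) (use dvd in auto)
  qed (use dvd u in auto)
  show "grp_root F w = u"
    unfolding grp_root_def e
  proof (rule the_equality)
    show "v = u" if "v \<in> carrier F \<and> w = v [^] r" for v
    proof -
      from that have v: "v \<in> carrier F" "w = v [^] r" by auto
      from pow[OF v] obtain k where k: "v = u [^] k \<and> int r = k * int r" ..
      then have "k = 1"
        using u(2) by simp
      then show ?thesis
        using k u(1) by simp
    qed
  qed (use u in auto)
qed

text \<open>The last two facts serve the algorithm: they bound a search for powers of
  \<open>u\<close> by the length of \<open>W\<close>.\<close>

lemma root_exp_reduced_word:
  assumes W: "W \<in> words_over X" "reduced W" "W \<noteq> []"
  defines "u \<equiv> grp_root F (eval W)" and "e \<equiv> grp_exp F (eval W)"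
  shows "u \<in> carrier F" "e > 0" "eval W = u [^] e"
    "\<And>x. x \<in> carrier F \<Longrightarrow> x \<otimes> eval W = eval W \<otimes> x \<Longrightarrow> \<exists>k::int. x = u [^] k"
    "\<And>n::nat. u [^] n = \<one> \<Longrightarrow> n = 0"
    "\<And>n. n \<le> e \<Longrightarrow> \<exists>i\<le>length W. \<exists>j\<le>length W. eval (take i W @ drop j W) = u [^] n"
    "e \<le> length W"
proof -
  obtain c t r where ctr: "W = c @ word_pow r t @ inv_word c" "r > 0"
    "\<And>n. eval (c @ word_pow n t @ inv_word c) = eval (c @ t @ inv_word c) [^] n"
    "\<And>x. x \<in> carrier F \<Longrightarrow> x \<otimes> eval W = eval W \<otimes> x \<Longrightarrow>
      \<exists>k::int. x = eval (c @ t @ inv_word c) [^] k"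
    "\<And>n::nat. eval (c @ t @ inv_word c) [^] n = \<one> \<Longrightarrow> n = 0"
    using root_word[OF W] by metis
  have "c \<in> words_over X" "t \<in> words_over X"
    using W ctr(1,2) by (cases r; simp)+
  then have cl: "eval (c @ t @ inv_word c) \<in> carrier F"
    by simp
  have Wr: "eval W = eval (c @ t @ inv_word c) [^] r"
    unfolding ctr(3)[symmetric] ctr(1)[symmetric] ..
  note eq = grp_exp_grp_root_eqI[OF cl ctr(2) Wr ctr(4,5)]
  have e: "e = r" and u: "u = eval (c @ t @ inv_word c)"
    using eq by (auto simp: e_def u_def)
  show "u \<in> carrier F" "e > 0" "eval W = u [^] e"
    using cl ctr(2) Wr by (simp_all add: e u)
  show "\<exists>k::int. x = u [^] k" if "x \<in> carrier F" "x \<otimes> eval W = eval W \<otimes> x" for x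
    using ctr(4)[OF that] by (simp add: u)
  show "n = 0" if "u [^] n = \<one>" for n :: nat
    using ctr(5) that by (simp add: u)
  have "t \<noteq> []"
    using ctr(3)[of 0] ctr(5)[of 1] cl by auto
  then have "r \<le> r * length t"
    by (cases t) auto
  then show "e \<le> length W"
    unfolding ctr(1) e length_append length_word_pow by linarith
  show "\<exists>i\<le>length W. \<exists>j\<le>length W. eval (take i W @ drop j W) = u [^] n" if "n \<le> e" for n
  proof -
    \<comment> \<open>The \<open>n\<close>-th copy of \<open>t\<close> ends at \<open>i\<close>; the
      last copy ends and \<open>inv_word c\<close> begins at \<open>j\<close>.\<close>
    define i j where "i = length c + n * length t" and "j = length c + r * length t"
    have n: "n + (r - n) = r"
      using that by (simp add: e)
    have "W = (c @ word_pow n t) @ (word_pow (r - n) t @ inv_word c)"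
      unfolding ctr(1) by (metis n append_assoc word_pow_add)
    then have "take i W = c @ word_pow n t"
      by (simp add: i_def)
    moreover have "W = (c @ word_pow r t) @ inv_word c"
      using ctr(1) by simp
    then have "drop j W = inv_word c"
      by (simp add: j_def)
    ultimately have "eval (take i W @ drop j W) = u [^] n"
      using ctr(3) by (simp add: u)
    moreover have "i \<le> j"
      using that by (simp add: i_def j_def e)
    moreover have "j \<le> length W"
      unfolding ctr(1) j_def by simp
    ultimately show ?thesis
      by (meson le_trans)
  qed
qed

end

section \<open>Groups belonging to a pseudovariety\<close>

text \<open>Members of \<open>V\<close> live on the natural numbers, so a finite group over another
  type is copied there, along an injection, before the closure properties of \<open>V\<close> are
  applied.\<close>

lemma finite_group_nat_copy:
  fixes G (structure)
  assumes "group G" "finite (carrier G)"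
  obtains H :: "nat monoid" where "group H" "finite (carrier H)" "G \<cong> H"
proof -
  interpret group G by fact
  obtain f :: "'a \<Rightarrow> nat" where f: "inj_on f (carrier G)"
    using finite_imp_inj_to_nat_seg[OF assms(2)] by blast
  define g where "g = inv_into (carrier G) f"
  have g: "g (f x) = x" if "x \<in> carrier G" for x
    using f that by (simp add: g_def)
  define H where "H = \<lparr>carrier = f ` carrier G, monoid.mult = (\<lambda>a b. f (g a \<otimes> g b)), one = f \<one>\<rparr>"
  have "f \<in> iso G H"
    using f by (auto simp: iso_def hom_def H_def g bij_betw_def)
  moreover have "group H"
  proof (rule groupI)
    fix y assume "y \<in> carrier H"
    then obtain x where "x \<in> carrier G" "y = f x"
      by (auto simp: H_def)
    then show "\<exists>z\<in>carrier H. z \<otimes>\<^bsub>H\<^esub> y = \<one>\<^bsub>H\<^esub>"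
      by (intro bexI[of _ "f (inv x)"]) (auto simp: H_def g)
  qed (auto simp: H_def g m_assoc)
  moreover have "finite (carrier H)"
    using assms(2) by (simp add: H_def)
  ultimately show thesis
    using that is_isoI by blast
qed

lemma mon_iso_image:
  assumes "group G" "group H" "h \<in> mon G H"
  shows "subgroup (h ` carrier G) H" "h \<in> iso G (H\<lparr>carrier := h ` carrier G\<rparr>)"
proof -
  interpret group_hom G H h
    using assms by (simp add: group_hom_def group_hom_axioms_def mon_def)
  show "subgroup (h ` carrier G) H"
    by (rule img_is_subgroup)
  show "h \<in> iso G (H\<lparr>carrier := h ` carrier G\<rparr>)"
    using assms(3) by (auto simp: mon_def iso_def hom_def bij_betw_def)
qed

text \<open>The regular wreath product, with \<open>G\<close> acting on functions by right
  translation. Along a word, the second component is the current vertex in the Cayley graph of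
  \<open>G\<close>, and the first collects the \<open>A\<close>-weights of the edges passed, for
  every starting vertex \<open>h\<close>.\<close>

definition wreath ::
  "('a, 'm) monoid_scheme \<Rightarrow> ('b, 'n) monoid_scheme \<Rightarrow> (('b \<Rightarrow> 'a) \<times> 'b) monoid" where
  "wreath A G = \<lparr>carrier = (carrier G \<rightarrow>\<^sub>E carrier A) \<times> carrier G,
     monoid.mult = (\<lambda>(f, g) (f', g'). (\<lambda>h\<in>carrier G. f h \<otimes>\<^bsub>A\<^esub> f' (h \<otimes>\<^bsub>G\<^esub> g), g \<otimes>\<^bsub>G\<^esub> g')),
     one = (\<lambda>h\<in>carrier G. \<one>\<^bsub>A\<^esub>, \<one>\<^bsub>G\<^esub>)\<rparr>"

lemma wreath_simps:
  "carrier (wreath A G) = (carrier G \<rightarrow>\<^sub>E carrier A) \<times> carrier G"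
  "(f, g) \<otimes>\<^bsub>wreath A G\<^esub> (f', g') =
    (\<lambda>h\<in>carrier G. f h \<otimes>\<^bsub>A\<^esub> f' (h \<otimes>\<^bsub>G\<^esub> g), g \<otimes>\<^bsub>G\<^esub> g')"
  "\<one>\<^bsub>wreath A G\<^esub> = (\<lambda>h\<in>carrier G. \<one>\<^bsub>A\<^esub>, \<one>\<^bsub>G\<^esub>)"
  by (simp_all add: wreath_def)

lemma wreath_inverse:
  assumes "group A" "group G" "f \<in> carrier G \<rightarrow>\<^sub>E carrier A" "g \<in> carrier G"
  defines "f' \<equiv> \<lambda>h\<in>carrier G. inv\<^bsub>A\<^esub> f (h \<otimes>\<^bsub>G\<^esub> inv\<^bsub>G\<^esub> g)"
  shows "(f', inv\<^bsub>G\<^esub> g) \<in> carrier (wreath A G)"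
    "(f', inv\<^bsub>G\<^esub> g) \<otimes>\<^bsub>wreath A G\<^esub> (f, g) = \<one>\<^bsub>wreath A G\<^esub>"
proof -
  interpret A: group A by fact
  interpret G: group G by fact
  have f: "f h \<in> carrier A" if "h \<in> carrier G" for h
    using assms that by auto
  show "(f', inv\<^bsub>G\<^esub> g) \<in> carrier (wreath A G)"
    using f assms(4) by (auto simp: wreath_simps f'_def)
  show "(f', inv\<^bsub>G\<^esub> g) \<otimes>\<^bsub>wreath A G\<^esub> (f, g) = \<one>\<^bsub>wreath A G\<^esub>"
    using f assms(4) by (auto simp: wreath_simps f'_def restrict_def fun_eq_iff)
qed

lemma group_wreath:
  assumes "group A" "group G"
  shows "group (wreath A G)"
proof (rule groupI)
  interpret A: group A by fact
  interpret G: group G by fact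
  show "x \<otimes>\<^bsub>wreath A G\<^esub> y \<in> carrier (wreath A G)"
    if "x \<in> carrier (wreath A G)" "y \<in> carrier (wreath A G)" for x y
    using that by (cases x; cases y) (auto simp: wreath_simps)
  show "\<one>\<^bsub>wreath A G\<^esub> \<in> carrier (wreath A G)"
    by (simp add: wreath_simps)
  show "x \<otimes>\<^bsub>wreath A G\<^esub> y \<otimes>\<^bsub>wreath A G\<^esub> z = x \<otimes>\<^bsub>wreath A G\<^esub> (y \<otimes>\<^bsub>wreath A G\<^esub> z)"
    if "x \<in> carrier (wreath A G)" "y \<in> carrier (wreath A G)" "z \<in> carrier (wreath A G)" for x y z
  proof -
    obtain f g f' g' f'' g'' where xyz: "x = (f, g)" "y = (f', g')" "z = (f'', g'')"
      by (cases x; cases y; cases z)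
    have cl: "f h \<in> carrier A" "f' h \<in> carrier A" "f'' h \<in> carrier A" if "h \<in> carrier G" for h
      using that \<open>x \<in> _\<close> \<open>y \<in> _\<close> \<open>z \<in> _\<close> by (auto simp: xyz wreath_simps)
    have "g \<in> carrier G" "g' \<in> carrier G" "g'' \<in> carrier G"
      using \<open>x \<in> _\<close> \<open>y \<in> _\<close> \<open>z \<in> _\<close> by (auto simp: xyz wreath_simps)
    then show ?thesis
      using cl by (auto simp: xyz wreath_simps A.m_assoc G.m_assoc intro!: restrict_ext)
  qed
  show "\<one>\<^bsub>wreath A G\<^esub> \<otimes>\<^bsub>wreath A G\<^esub> x = x" if "x \<in> carrier (wreath A G)" for x
  proof -
    obtain f g where x: "x = (f, g)"
      by (cases x)
    have f: "f \<in> carrier G \<rightarrow>\<^sub>E carrier A" and g: "g \<in> carrier G"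
      using that by (auto simp: x wreath_simps)
    have "(\<lambda>h\<in>carrier G. (\<lambda>h\<in>carrier G. \<one>\<^bsub>A\<^esub>) h \<otimes>\<^bsub>A\<^esub> f (h \<otimes>\<^bsub>G\<^esub> \<one>\<^bsub>G\<^esub>)) = f"
      by (rule ext) (use f PiE_mem[OF f] in \<open>auto simp: restrict_def\<close>)
    then show ?thesis
      using g by (simp add: x wreath_simps)
  qed
  show "\<exists>y\<in>carrier (wreath A G). y \<otimes>\<^bsub>wreath A G\<^esub> x = \<one>\<^bsub>wreath A G\<^esub>"
    if x: "x \<in> carrier (wreath A G)" for x
  proof (cases x)
    case (Pair f g)
    then have "f \<in> carrier G \<rightarrow>\<^sub>E carrier A" "g \<in> carrier G"
      using x by (auto simp: wreath_simps)
    from wreath_inverse[OF assms this] show ?thesis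
      unfolding Pair by blast
  qed
qed

lemma inv_wreath:
  assumes "group A" "group G" "f \<in> carrier G \<rightarrow>\<^sub>E carrier A" "g \<in> carrier G"
  shows "inv\<^bsub>wreath A G\<^esub> (f, g) = (\<lambda>h\<in>carrier G. inv\<^bsub>A\<^esub> f (h \<otimes>\<^bsub>G\<^esub> inv\<^bsub>G\<^esub> g), inv\<^bsub>G\<^esub> g)"
  using wreath_inverse[OF assms] assms
  by (intro group.inv_equality[OF group_wreath]) (auto simp: wreath_simps)

lemma snd_epi_wreath:
  assumes "group A" "group G"
  shows "snd \<in> epi (wreath A G) G"
proof -
  have "g \<in> snd ` carrier (wreath A G)" if "g \<in> carrier G" for g
    using that assms by (intro image_eqI[of _ _ "(\<lambda>h\<in>carrier G. \<one>\<^bsub>A\<^esub>, g)"])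
      (auto simp: wreath_simps group.is_monoid)
  then show ?thesis
    by (auto simp: epi_def hom_def wreath_simps)
qed

text \<open>On the kernel of \<open>snd\<close> the translation is trivial, so that multiplication
  is pointwise.\<close>

lemma fst_mon_kernel_wreath:
  assumes "group A" "group G"
  shows "fst \<in> mon (wreath A G\<lparr>carrier := kernel (wreath A G) G snd\<rparr>) (product_group (carrier G) (\<lambda>_. A))"
proof -
  interpret G: group G by fact
  show ?thesis
    by (auto simp: mon_def hom_def kernel_def wreath_simps inj_on_def intro!: restrict_ext)
qed

lemma card_wreath:
  assumes "finite (carrier G)"
  shows "card (carrier (wreath A G)) = card (carrier A) ^ card (carrier G) * card (carrier G)"
  using assms by (simp add: wreath_simps card_cartesian_product card_PiE)

section \<open>Closure properties of the class for groups over arbitrary types\<close>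

locale extension_closed_pseudovariety =
  fixes V :: "nat monoid set"
  assumes pseudovariety: "pseudovariety V" and extension_closed: "extension_closed V"
begin

lemma in_V_group: "H \<in> V \<Longrightarrow> group H" "H \<in> V \<Longrightarrow> finite (carrier H)"
  using pseudovariety by (auto simp: pseudovariety_def)

lemma in_class_self: "H \<in> V \<Longrightarrow> in_class H V"
  unfolding in_class_def using iso_refl by blast

lemma in_class_finite:
  assumes "in_class G V"
  shows "finite (carrier G)"
  using assms in_V_group(2) iso_finite unfolding in_class_def by metis

lemma in_class_epi:
  assumes "in_class G V" "group G" "group G'" "h \<in> epi G G'"
  shows "in_class G' V"
proof -
  obtain H \<psi> where H: "H \<in> V" "\<psi> \<in> iso H G"
    using assms(1,2) group.iso_sym unfolding in_class_def is_iso_def by blast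
  have "finite (carrier G')"
    using in_class_finite[OF assms(1)] assms(4) by (auto simp: epi_def dest: sym)
  then obtain H' :: "nat monoid" where H': "group H'" "G' \<cong> H'"
    using finite_group_nat_copy[OF assms(3)] by blast
  then obtain \<kappa> where \<kappa>: "\<kappa> \<in> iso G' H'"
    unfolding is_iso_def by blast
  have "\<kappa> \<circ> (h \<circ> \<psi>) \<in> epi H H'"
    using H(2) \<kappa> assms(4) by (intro epi_compose) (auto simp: iso_iff_mon_epi)
  then have "H' \<in> V"
    using pseudovariety H(1) H'(1) unfolding pseudovariety_def by blast
  then show ?thesis
    using H'(2) unfolding in_class_def by blast
qed

lemma in_class_iso:
  assumes "in_class G V" "G' \<cong> G"
  shows "in_class G' V"
  using assms iso_trans unfolding in_class_def by blast

lemma in_class_mon: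
  assumes "in_class G V" "group G" "group K" "h \<in> mon K G"
  shows "in_class K V"
proof -
  obtain H \<psi> where H: "H \<in> V" "\<psi> \<in> iso G H"
    using assms(1) unfolding in_class_def is_iso_def by blast
  have "\<psi> \<circ> h \<in> mon K H"
    using H(2) assms(4) by (intro mon_compose) (auto simp: iso_iff_mon_epi)
  note im = mon_iso_image[OF assms(3) in_V_group(1)[OF H(1)] this]
  have "H\<lparr>carrier := (\<psi> \<circ> h) ` carrier K\<rparr> \<in> V"
    using pseudovariety H(1) im(1) unfolding pseudovariety_def by blast
  then show ?thesis
    using im(2) is_isoI unfolding in_class_def by blast
qed

lemma in_class_trivial:
  assumes "trivial_group G"
  shows "in_class G V"
proof -
  have "group G" "finite (carrier G)"
    using assms by (auto simp: trivial_group_def)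
  then obtain H :: "nat monoid" where H: "group H" "G \<cong> H"
    by (rule finite_group_nat_copy)
  then have "trivial_group H"
    using assms isomorphic_group_triviality \<open>group G\<close> by blast
  then show ?thesis
    using pseudovariety H(2) unfolding pseudovariety_def in_class_def by blast
qed

lemma in_class_DirProd:
  assumes "in_class G V" "in_class H V" "group G"
  shows "in_class (G \<times>\<times> H) V"
proof -
  obtain G' H' where *: "G' \<in> V" "G \<cong> G'" "H' \<in> V" "H \<cong> H'"
    using assms(1,2) unfolding in_class_def by blast
  then have "in_class (G' \<times>\<times> H') V"
    using pseudovariety unfolding pseudovariety_def by blast
  moreover have "G \<times>\<times> H \<cong> G' \<times>\<times> H'"
    using * group.DirProd_iso_trans[OF assms(3)] by blast
  ultimately show ?thesis
    by (rule in_class_iso)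
qed

text \<open>Splitting off one coordinate embeds the product into a binary one, so induction on
  \<open>I\<close> applies.\<close>

lemma in_class_product_group:
  assumes "finite I" "in_class A V" "group A"
  shows "in_class (product_group I (\<lambda>_. A)) V"
  using assms(1)
proof (induction I rule: finite_induct)
  case empty
  then show ?case
    by (intro in_class_trivial) (simp add: trivial_product_group)
next
  case (insert i I)
  have mon: "(\<lambda>f. (f i, restrict f I)) \<in>
      mon (product_group (insert i I) (\<lambda>_. A)) (A \<times>\<times> product_group I (\<lambda>_. A))"
  proof -
    have "f = g" if "f \<in> insert i I \<rightarrow>\<^sub>E carrier A" "g \<in> insert i I \<rightarrow>\<^sub>E carrier A"
      "f i = g i" "restrict f I = restrict g I" for f g
    proof (rule PiE_ext[OF that(1,2)])
      show "f j = g j" if "j \<in> insert i I" for j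
        using that \<open>f i = g i\<close> \<open>restrict f I = restrict g I\<close> by (metis insertE restrict_apply')
    qed
    then show ?thesis
      by (auto simp: mon_def hom_def inj_on_def PiE_mem intro!: restrict_ext)
  qed
  show ?case
    using insert.IH assms(2,3)
    by (intro in_class_mon[OF in_class_DirProd _ _ mon] DirProd_group) simp_all
qed

text \<open>\<open>G\<close> is finite, being a finite union of fibres of \<open>h\<close>, each
  contained in a coset of the finite kernel. Extension closure is then applied to a copy
  \<open>H\<close> of \<open>G\<close> and the kernel of \<open>h \<circ> \<psi>\<close>.\<close>

lemma in_class_extension:
  assumes "group G" "group Q" "h \<in> epi G Q" "in_class Q V"
    and "in_class (G\<lparr>carrier := kernel G Q h\<rparr>) V"
  shows "in_class G V"
proof -
  interpret h: group_hom G Q h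
    using assms by (simp add: group_hom_def group_hom_axioms_def epi_def)
  have "finite (carrier G)"
  proof -
    have fib: "finite (h -` {q} \<inter> carrier G)" for q
    proof (cases "h -` {q} \<inter> carrier G = {}")
      case False
      then obtain x where x: "x \<in> carrier G" "h x = q" by blast
      have "h -` {q} \<inter> carrier G \<subseteq> (\<lambda>k. k \<otimes>\<^bsub>G\<^esub> x) ` kernel G Q h"
      proof
        fix y assume "y \<in> h -` {q} \<inter> carrier G"
        then show "y \<in> (\<lambda>k. k \<otimes>\<^bsub>G\<^esub> x) ` kernel G Q h"
          using x by (intro image_eqI[of _ _ "y \<otimes>\<^bsub>G\<^esub> inv\<^bsub>G\<^esub> x"]) (auto simp: kernel_def h.G.m_assoc)
      qed
      moreover have "finite (kernel G Q h)"
        using in_class_finite[OF assms(5)] by simp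
      ultimately show ?thesis
        using finite_subset by blast
    qed simp
    have "carrier G = (\<Union>q\<in>carrier Q. h -` {q} \<inter> carrier G)"
      by auto
    then show ?thesis
      using fib in_class_finite[OF assms(4)] by (metis (no_types, lifting) finite_UN)
  qed
  then obtain H :: "nat monoid" where H: "group H" "finite (carrier H)" "G \<cong> H"
    using finite_group_nat_copy assms(1) by blast
  then obtain \<psi> where \<psi>: "\<psi> \<in> iso H G"
    using h.G.iso_sym unfolding is_iso_def by blast
  have e: "h \<circ> \<psi> \<in> epi H Q"
    using \<psi> assms(3) by (intro epi_compose) (auto simp: iso_iff_mon_epi)
  interpret k: group_hom H Q "h \<circ> \<psi>"
    using e H assms(2) by (simp add: group_hom_def group_hom_axioms_def epi_def)
  define N where "N = kernel H Q (h \<circ> \<psi>)"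
  have N: "N \<lhd> H"
    unfolding N_def by (rule k.normal_kernel)
  have "H Mod N \<cong> Q"
    unfolding N_def using e by (intro k.FactGroup_iso) (simp add: epi_def)
  then have "in_class (H Mod N) V"
    using assms(4) in_class_iso by blast
  moreover have "in_class (H\<lparr>carrier := N\<rparr>) V"
  proof (rule in_class_mon[OF assms(5)])
    show "group (G\<lparr>carrier := kernel G Q h\<rparr>)" "group (H\<lparr>carrier := N\<rparr>)"
      using h.subgroup_kernel N H(1) assms(1) subgroup.subgroup_is_group normal_imp_subgroup by blast+
    show "\<psi> \<in> mon (H\<lparr>carrier := N\<rparr>) (G\<lparr>carrier := kernel G Q h\<rparr>)"
      using \<psi> by (auto simp: mon_def iso_def hom_def bij_betw_def N_def kernel_def inj_on_def)
  qed
  ultimately have "H \<in> V"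
    using extension_closed H N unfolding extension_closed_def by blast
  then show ?thesis
    using H(3) unfolding in_class_def by blast
qed

lemma in_class_wreath:
  assumes "group A" "group G" "in_class A V" "in_class G V"
  shows "in_class (wreath A G) V"
proof (rule in_class_extension[OF group_wreath[OF assms(1,2)] assms(2) snd_epi_wreath[OF assms(1,2)] assms(4)])
  interpret snd: group_hom "wreath A G" G snd
    using group_wreath[OF assms(1,2)] snd_epi_wreath[OF assms(1,2)] assms(2)
    by (simp add: group_hom_def group_hom_axioms_def epi_def)
  show "in_class (wreath A G\<lparr>carrier := kernel (wreath A G) G snd\<rparr>) V"
    using in_class_finite[OF assms(4)] assms
      snd.subgroup_kernel[THEN subgroup.subgroup_is_group, OF group_wreath[OF assms(1,2)]]
    by (intro in_class_mon[OF in_class_product_group _ _ fst_mon_kernel_wreath]) simp_all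
qed

lemma in_class_cyclic_dvd:
  assumes "in_class (integer_mod_group k) V" "d dvd k" "k > 0"
  shows "in_class (integer_mod_group d) V"
proof (rule in_class_epi[OF assms(1)])
  have d: "d > 0" "d \<le> k"
    using assms by (auto intro: Nat.gr0I dvd_imp_le)
  have "(\<lambda>x. x mod int d) \<in> hom (integer_mod_group k) (integer_mod_group d)"
    using assms d by (auto simp: hom_def carrier_integer_mod_group mod_mod_cancel mod_simps)
  moreover have "x \<in> (\<lambda>x. x mod int d) ` carrier (integer_mod_group k)"
    if "x \<in> carrier (integer_mod_group d)" for x
    using that d by (intro image_eqI[of _ _ x]) (auto simp: carrier_integer_mod_group)
  ultimately show "(\<lambda>x. x mod int d) \<in> epi (integer_mod_group k) (integer_mod_group d)"
    by (auto simp: epi_iff_subset)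
qed auto

text \<open>Reduction modulo \<open>a\<close> has the multiples of \<open>a\<close> as its kernel,
  and these are a homomorphic image of the cyclic group of order \<open>b\<close>.\<close>

lemma in_class_cyclic_mult:
  assumes "in_class (integer_mod_group a) V" "in_class (integer_mod_group b) V" "a > 0" "b > 0"
  shows "in_class (integer_mod_group (a * b)) V"
proof -
  let ?h = "\<lambda>x. x mod int a"
  have hom: "?h \<in> hom (integer_mod_group (a * b)) (integer_mod_group a)"
    using assms by (auto simp: hom_def carrier_integer_mod_group mod_mod_cancel mod_simps)
  have ab: "int a \<le> int a * int b"
    using assms(3,4) by (simp flip: of_nat_mult)
  have epi: "?h \<in> epi (integer_mod_group (a * b)) (integer_mod_group a)"
  proof -
    have "x \<in> ?h ` carrier (integer_mod_group (a * b))" if "x \<in> carrier (integer_mod_group a)" for x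
    proof -
      have "0 \<le> x" "x < int a"
        using that assms(3) by (auto simp: carrier_integer_mod_group)
      moreover from \<open>x < int a\<close> ab have "x < int a * int b"
        by (rule less_le_trans)
      ultimately show ?thesis
        using assms(3,4) by (intro image_eqI[of _ _ x]) (auto simp: carrier_integer_mod_group)
    qed
    then show ?thesis
      using hom by (auto simp: epi_iff_subset)
  qed
  interpret h: group_hom "integer_mod_group (a * b)" "integer_mod_group a" ?h
    using hom by (simp add: group_hom_def group_hom_axioms_def)
  let ?K = "(integer_mod_group (a * b))\<lparr>carrier := kernel (integer_mod_group (a * b)) (integer_mod_group a) ?h\<rparr>"
  have "(\<lambda>x. int a * x) \<in> epi (integer_mod_group b) ?K"
  proof -
    have "(\<lambda>x. int a * x) \<in> hom (integer_mod_group b) ?K"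
      using assms by (auto simp: hom_def carrier_integer_mod_group kernel_def mult_mod_right distrib_left)
    moreover have "x \<in> (\<lambda>x. int a * x) ` carrier (integer_mod_group b)" if "x \<in> carrier ?K" for x
    proof -
      have x: "x = int a * (x div int a)" "0 \<le> x" "x < int a * int b"
        using that assms by (auto simp: kernel_def carrier_integer_mod_group)
      then have "int a * (x div int a) < int a * int b"
        by simp
      then have "x div int a < int b"
        using assms(3) by simp
      moreover have "0 \<le> x div int a"
        using x(2) assms(3) by (simp add: pos_imp_zdiv_nonneg_iff)
      ultimately show ?thesis
        using x(1)
        using assms by (intro image_eqI[of _ _ "x div int a"]) (auto simp: carrier_integer_mod_group)
    qed
    ultimately show ?thesis
      by (auto simp: epi_iff_subset)
  qed
  note K = in_class_epi[OF assms(2) _ _ this]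
  have "group ?K"
    by (rule subgroup.subgroup_is_group[OF h.subgroup_kernel]) simp
  then have "in_class ?K V"
    by (intro K) simp_all
  then show ?thesis
    by (intro in_class_extension[OF _ _ epi assms(1)]) simp_all
qed

text \<open>The powers of \<open>a\<close> embed the cyclic group of order \<open>ord a\<close> into
  \<open>G\<close>.\<close>

lemma in_class_cyclic_ord:
  fixes G (structure)
  assumes "in_class G V" "group G" "a \<in> carrier G"
  shows "in_class (integer_mod_group (group.ord G a)) V" "group.ord G a > 0"
proof -
  interpret group G by fact
  show pos: "ord a > 0"
    using in_class_finite[OF assms(1)] assms(3) ord_ge_1 by fastforce
  show "in_class (integer_mod_group (ord a)) V"
  proof (rule in_class_mon[OF assms(1,2)])
    have "a [^] ((x + y) mod int (ord a)) = a [^] (x + y)" for x y :: int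
      using assms(3) by (subst int_pow_eq) (auto simp: mod_eq_dvd_iff)
    then show "(\<lambda>k. a [^] (k::int)) \<in> mon (integer_mod_group (ord a)) G"
      using assms(3) pos
      by (auto simp: mon_def hom_def inj_on_def int_pow_eq int_pow_mult carrier_integer_mod_group
          simp flip: mod_eq_dvd_iff)
  qed simp
qed

lemma in_class_cyclic_1: "in_class (integer_mod_group 1) V"
  by (intro in_class_trivial) (simp add: trivial_integer_mod_group)

lemma prime_cyclic_in_class:
  assumes "nontrivial_class V"
  obtains p where "prime p" "in_class (integer_mod_group p) V"
proof -
  obtain G where G: "G \<in> V" "\<not> trivial_group G"
    using assms by (auto simp: nontrivial_class_def)
  interpret group G
    using G in_V_group by blast
  obtain a where a: "a \<in> carrier G" "a \<noteq> \<one>\<^bsub>G\<^esub>"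
    using G(2) trivial_group_subset by blast
  note ord = in_class_cyclic_ord[OF in_class_self[OF G(1)] _ a(1)]
  obtain p where "prime p" "p dvd ord a"
    using prime_factor_nat ord_eq_1[OF a(1)] a(2) by blast
  then show thesis
    using that in_class_cyclic_dvd ord is_group by blast
qed

end

section \<open>Separation of elements of a free group\<close>

text \<open>A further letter multiplies the weight of the path starting at \<open>h\<close> by the
  weight of one more edge, read at the vertex reached so far.\<close>

lemma word_eval_wreath_snoc:
  fixes p :: "('i \<times> bool) list"
  assumes "group A" "group G" "y \<in> UNIV \<rightarrow> carrier (wreath A G)" "h \<in> carrier G"
  shows "fst (word_eval (wreath A G) y (p @ [l])) h =
    fst (word_eval (wreath A G) y p) h \<otimes>\<^bsub>A\<^esub>
      fst (letter (wreath A G) y l) (h \<otimes>\<^bsub>G\<^esub> word_eval G (snd \<circ> y) p)"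
proof -
  interpret W: group "wreath A G"
    using assms by (intro group_wreath)
  have ov: "q \<in> words_over UNIV" for q :: "('i \<times> bool) list"
    by (auto simp: words_over_def)
  have cl: "letter (wreath A G) y l \<in> carrier (wreath A G)"
    using W.letter_closed[OF assms(3)] by simp
  have "word_eval (wreath A G) y (p @ [l]) =
      word_eval (wreath A G) y p \<otimes>\<^bsub>wreath A G\<^esub> letter (wreath A G) y l"
    using cl by (simp add: W.word_eval_append[OF assms(3) ov ov])
  moreover have "snd (word_eval (wreath A G) y p) = word_eval G (snd \<circ> y) p"
    using snd_epi_wreath[OF assms(1,2)] W.is_group assms(2,3)
    by (intro word_eval_hom[OF _ _ _ _ ov]) (auto simp: epi_def)
  ultimately show ?thesis
    using assms(4) by (cases "word_eval (wreath A G) y p"; cases "letter (wreath A G) y l")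
      (simp add: wreath_simps)
qed

text \<open>An inverse letter runs through an edge backwards: it contributes the inverse weight, and
  the edge is looked up at the vertex where the step ends.\<close>

lemma letter_wreath:
  assumes "group A" "group G" "y \<in> UNIV \<rightarrow> carrier (wreath A G)" "h \<in> carrier G"
  shows "fst (letter (wreath A G) y l) h =
    (if snd l then fst (y (fst l)) h
     else inv\<^bsub>A\<^esub> fst (y (fst l)) (h \<otimes>\<^bsub>G\<^esub> inv\<^bsub>G\<^esub> snd (y (fst l))))"
proof -
  have "y (fst l) \<in> carrier (wreath A G)"
    using assms(3) by auto
  then show ?thesis
    using assms(4) inv_wreath[OF assms(1,2), of "fst (y (fst l))" "snd (y (fst l))"]
    by (auto simp: letter_def wreath_simps)
qed

lemma ex_neq_one:
  assumes "group A" "card (carrier A) > 1"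
  obtains a where "a \<in> carrier A" "a \<noteq> \<one>\<^bsub>A\<^esub>"
proof -
  have "carrier A \<noteq> {\<one>\<^bsub>A\<^esub>}"
    using assms(2) by auto
  then show thesis
    using that group.is_monoid[OF assms(1)] monoid.one_closed by blast
qed

text \<open>
  A word \<open>w\<close> describes a path in the Cayley graph of \<open>G\<close>. If the path is simple except that its
  last vertex repeats an earlier one, then it closes a simple loop, whose last edge occurs in it
  only once. In the wreath product with \<open>A\<close>, one can give this edge a weight \<open>a \<noteq> \<one>\<close> and all
  the others weight \<open>\<one>\<close>, so that the loop is no longer closed.
\<close>

lemma wreath_separates_prefixes:
  fixes w :: "('i \<times> bool) list"
  assumes "group A" "group G" and a: "a \<in> carrier A" "a \<noteq> \<one>\<^bsub>A\<^esub>"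
    and x: "range x \<subseteq> carrier G"
    and inj: "inj_on (\<lambda>n. word_eval G x (take n w)) {..length w}"
    and red: "reduced (w @ [l])"
  shows "\<exists>y. range y \<subseteq> carrier (wreath A G) \<and>
    inj_on (\<lambda>n. word_eval (wreath A G) y (take n (w @ [l]))) {..length (w @ [l])}"
proof -
  interpret A: group A by fact
  interpret G: group G by fact
  interpret W: group "wreath A G"
    using assms by (intro group_wreath)
  have ov: "q \<in> words_over UNIV" for q :: "('i \<times> bool) list"
    by (auto simp: words_over_def)
  have x': "x \<in> UNIV \<rightarrow> carrier G" and xc [simp]: "x i \<in> carrier G" for i
    using x by auto
  have wc [simp]: "word_eval G x q \<in> carrier G" for q
    using G.word_eval_closed[OF x' ov] .
  define P where "P n = word_eval G x (take n (w @ [l]))" for n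
  define N where "N = length w"
  have Pc [simp]: "P n \<in> carrier G" for n
    by (simp add: P_def)
  have P_inj: "m = n" if "P m = P n" "m \<le> N" "n \<le> N" for m n
    using inj_onD[OF inj, of m n] that by (simp add: P_def N_def)
  have take_Suc: "take (Suc n) (w @ [l]) = take n (w @ [l]) @ [(w @ [l]) ! n]" if "n \<le> N" for n
    using that by (intro take_Suc_conv_app_nth) (simp add: N_def)
  have P_Suc: "P (Suc n) = P n \<otimes>\<^bsub>G\<^esub> letter G x ((w @ [l]) ! n)" if "n \<le> N" for n
    using take_Suc[OF that] G.letter_closed[OF x']
    by (simp add: P_def G.word_eval_append[OF x' ov ov] del: take_append)
  have adj: "(w @ [l]) ! Suc n \<noteq> flip ((w @ [l]) ! n)" if "Suc n \<le> N" for n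
    using red that successively_conv_nth[of "\<lambda>l m. m \<noteq> flip l" "w @ [l]"]
    by (simp add: reduced_iff_flip N_def)
  \<comment> \<open>An edge is given by its generator and its initial vertex in the positive
    direction. The last step uses the edge \<open>(i0, g0)\<close>; for an inverse letter, the
    initial vertex is the one reached after the step.\<close>
  define i0 g0 where "i0 = fst l" and "g0 = (if snd l then P N else P (Suc N))"
  have last: "(w @ [l]) ! N = l"
    by (simp add: N_def)
  define y where "y i = (\<lambda>h\<in>carrier G. if i = i0 \<and> h = g0 then a else \<one>\<^bsub>A\<^esub>, x i)" for i
  have yW: "range y \<subseteq> carrier (wreath A G)"
    using a(1) by (auto simp: y_def wreath_simps)
  then have y: "y \<in> UNIV \<rightarrow> carrier (wreath A G)"
    by auto
  have snd_y: "snd \<circ> y = x"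
    by (auto simp: y_def)
  have snd_eval: "snd (word_eval (wreath A G) y q) = word_eval G x q" for q
    using snd_epi_wreath[OF assms(1,2)] y word_eval_hom[OF W.is_group assms(2) _ y ov, of snd q]
    by (simp add: epi_def snd_y)
  \<comment> \<open>\<open>E n\<close> is the weight collected in the first \<open>n\<close> steps
    from the identity vertex, and \<open>wt n\<close> is the contribution of the step from
    \<open>P n\<close> to \<open>P (Suc n)\<close>.\<close>
  define E where "E n = fst (word_eval (wreath A G) y (take n (w @ [l]))) \<one>\<^bsub>G\<^esub>" for n
  define wt where "wt n = fst (letter (wreath A G) y ((w @ [l]) ! n)) (P n)" for n
  have E_Suc: "E (Suc n) = E n \<otimes>\<^bsub>A\<^esub> wt n" if "n \<le> N" for n
    using take_Suc[OF that]
    by (simp add: E_def wt_def P_def word_eval_wreath_snoc[OF assms(1,2) y] snd_y del: take_append)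
  have Ec: "E n \<in> carrier A" for n
  proof -
    have "word_eval (wreath A G) y (take n (w @ [l])) \<in> carrier (wreath A G)"
      using W.word_eval_closed[OF y ov] .
    then show ?thesis
      by (auto simp: E_def wreath_simps)
  qed
  have wt: "wt n = (if fst ((w @ [l]) ! n) = i0 \<and> (if snd ((w @ [l]) ! n) then P n else P (Suc n)) = g0
      then (if snd ((w @ [l]) ! n) then a else inv\<^bsub>A\<^esub> a) else \<one>\<^bsub>A\<^esub>)" if "n \<le> N" for n
    unfolding wt_def letter_wreath[OF assms(1,2) y Pc]
    using P_Suc[OF that] by (auto simp: y_def letter_def)
  have wt_last: "wt N \<noteq> \<one>\<^bsub>A\<^esub>" "wt N \<in> carrier A"
    using a by (auto simp: wt last i0_def g0_def)
  have ne: "word_eval (wreath A G) y (take m (w @ [l])) \<noteq> word_eval (wreath A G) y (take n (w @ [l]))"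
    if "m < n" "n \<le> Suc N" for m n
  proof
    assume eq: "word_eval (wreath A G) y (take m (w @ [l])) = word_eval (wreath A G) y (take n (w @ [l]))"
    then have PP: "P m = P n"
      using snd_eval unfolding P_def by metis
    \<comment> \<open>The path is simple before the last step, so only its final vertex can be a
      repetition.\<close>
    then have n: "n = Suc N"
      using P_inj[of m n] that by (cases "n = Suc N") auto
    \<comment> \<open>An earlier step of the loop through the chosen edge would, by injectivity of
      the earlier vertices, be the one just before the last and run in the opposite direction,
      against reducedness.\<close>
    have wt_1: "wt k = \<one>\<^bsub>A\<^esub>" if k: "m \<le> k" "k < N" for k
    proof (rule ccontr)
      assume "wt k \<noteq> \<one>\<^bsub>A\<^esub>"
      then have i: "fst ((w @ [l]) ! k) = i0"
        and g: "(if snd ((w @ [l]) ! k) then P k else P (Suc k)) = g0"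
        using wt[of k] k by (auto split: if_splits)
      have "k \<le> N" "Suc k \<le> N" "m \<le> N"
        using k by auto
      show False
      proof (cases "snd l")
        case True
        then have "\<not> snd ((w @ [l]) ! k)"
          using g P_inj[of k N] k by (auto simp: g0_def)
        moreover from this have "Suc k = N"
          using g True P_inj[of "Suc k" N] k by (auto simp: g0_def)
        ultimately show False
          using adj[of k] True i last by (auto simp: flip_def i0_def prod_eq_iff)
      next
        case False
        \<comment> \<open>Here \<open>g0 = P (Suc N) = P m\<close>. A negative step would give
          \<open>P (Suc k) = P m\<close>, impossible for \<open>m \<le> k\<close>; a positive one
          gives \<open>P k = P m\<close> and so \<open>k = m\<close>.\<close>
        have "snd ((w @ [l]) ! k)"
          using g False P_inj[of "Suc k" m] k n PP by (auto simp: g0_def split: if_splits)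
        moreover from this have "k = m"
          using g False P_inj[of k m] k n PP by (auto simp: g0_def split: if_splits)
        moreover have "Suc k = N"
        proof (rule P_inj)
          have "P (Suc k) = P (Suc N) \<otimes>\<^bsub>G\<^esub> x i0"
            using P_Suc[of k] \<open>snd ((w @ [l]) ! k)\<close> i \<open>k = m\<close> PP n \<open>k \<le> N\<close> by (simp add: letter_def)
          also have "\<dots> = P N"
            using P_Suc[of N] False last by (simp add: letter_def i0_def G.m_assoc)
          finally show "P (Suc k) = P N" .
        qed (use k in auto)
        ultimately show False
          using adj[of k] False i last by (auto simp: flip_def i0_def prod_eq_iff)
      qed
    qed
    have const: "E k = E m" if "m \<le> k" "k \<le> N" for k
      using that
    proof (induction k rule: dec_induct)
      case (step k)
      then show ?case
        using E_Suc[of k] wt_1[of k] Ec by simp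
    qed simp
    have "E (Suc N) = E m"
      using eq n by (simp add: E_def)
    then have "E N \<otimes>\<^bsub>A\<^esub> wt N = E N"
      using E_Suc[of N] const[of N] that n by simp
    then show False
      using Ec wt_last by simp
  qed
  have "inj_on (\<lambda>n. word_eval (wreath A G) y (take n (w @ [l]))) {..length (w @ [l])}"
  proof (rule inj_onI)
    fix m n assume "m \<in> {..length (w @ [l])}" "n \<in> {..length (w @ [l])}"
      and eq: "word_eval (wreath A G) y (take m (w @ [l])) = word_eval (wreath A G) y (take n (w @ [l]))"
    then have mn: "m \<le> Suc N" "n \<le> Suc N"
      by (auto simp: N_def)
    show "m = n"
      using ne[of m n] ne[of n m] eq mn by (cases m n rule: linorder_cases) auto
  qed
  then show ?thesis
    using yW by blast
qed

context extension_closed_pseudovariety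
begin

lemma trivial_in_V: "trivial_group G \<Longrightarrow> G \<in> V"
  using pseudovariety unfolding pseudovariety_def by blast

text \<open>The induction needs all prefixes separated, because
  \<open>wreath_separates_prefixes\<close> starts from a simple path. Each letter costs one wreath
  product of a cyclic group of order \<open>p\<close> with the previous group, so the order remains
  a power of \<open>p\<close>.\<close>

lemma separate_prefixes:
  fixes w :: "('i \<times> bool) list"
  assumes "prime p" "in_class (integer_mod_group p) V" "reduced w"
  shows "\<exists>H\<in>V. \<exists>k x. card (carrier H) = p ^ k \<and> range x \<subseteq> carrier H \<and>
    inj_on (\<lambda>n. word_eval H x (take n w)) {..length w}"
  using assms(3)
proof (induction w rule: rev_induct)
  case Nil
  have "singleton_group 0 \<in> V"
    by (simp add: trivial_in_V)
  then show ?case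
    by (intro bexI[of _ "singleton_group 0"] exI[of _ 0] exI[of _ "\<lambda>_. 0"]) auto
next
  case (snoc l w)
  then obtain H k and x :: "'i \<Rightarrow> nat" where H: "H \<in> V" and k: "card (carrier H) = p ^ k"
    and x: "range x \<subseteq> carrier H" and inj: "inj_on (\<lambda>n. word_eval H x (take n w)) {..length w}"
    by (auto simp: reduced_append)
  obtain A where A: "A \<in> V" "integer_mod_group p \<cong> A"
    using assms(2) by (auto simp: in_class_def)
  have card_A: "card (carrier A) = p"
    using iso_same_card[OF A(2)] prime_gt_0_nat[OF assms(1)] by (simp add: carrier_integer_mod_group)
  obtain a where a: "a \<in> carrier A" "a \<noteq> \<one>\<^bsub>A\<^esub>"
    using ex_neq_one[OF in_V_group(1)[OF A(1)]] card_A prime_gt_1_nat[OF assms(1)] by metis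
  note grp = in_V_group(1)[OF A(1)] in_V_group(1)[OF H]
  from wreath_separates_prefixes[OF grp a x inj snoc.prems]
  obtain y where yy: "range y \<subseteq> carrier (wreath A H) \<and>
    inj_on (\<lambda>n. word_eval (wreath A H) y (take n (w @ [l]))) {..length (w @ [l])}" ..
  note y = yy[THEN conjunct1] yy[THEN conjunct2]
  have "in_class (wreath A H) V"
    using grp A(1) H by (intro in_class_wreath in_class_self)
  then obtain H' \<psi> where H': "H' \<in> V" "\<psi> \<in> iso (wreath A H) H'"
    unfolding in_class_def is_iso_def by blast
  have W: "group (wreath A H)"
    using grp by (rule group_wreath)
  have card: "card (carrier H') = p ^ (p ^ k + k)"
    using card_wreath[OF in_V_group(2)[OF H], of A] iso_same_card[OF is_isoI[OF H'(2)]]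
    by (simp add: card_A k power_add)
  have ov: "q \<in> words_over UNIV" for q :: "('i \<times> bool) list"
    by (auto simp: words_over_def)
  have y': "y \<in> UNIV \<rightarrow> carrier (wreath A H)"
    using y(1) by auto
  have eval_\<psi>: "word_eval H' (\<psi> \<circ> y) q = \<psi> (word_eval (wreath A H) y q)" for q
    using word_eval_hom[OF W in_V_group(1)[OF H'(1)] _ y' ov] H'(2) by (simp add: iso_def)
  have "(\<lambda>n. word_eval (wreath A H) y (take n (w @ [l]))) ` {..length (w @ [l])} \<subseteq> carrier (wreath A H)"
    using group.word_eval_closed[OF W y' ov] by (rule image_subsetI)
  moreover have "inj_on \<psi> (carrier (wreath A H))"
    using H'(2) by (simp add: iso_def bij_betw_def)
  ultimately have "inj_on \<psi> ((\<lambda>n. word_eval (wreath A H) y (take n (w @ [l]))) ` {..length (w @ [l])})"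
    by (metis inj_on_subset)
  from comp_inj_on[OF y(2) this]
  have "inj_on (\<lambda>n. word_eval H' (\<psi> \<circ> y) (take n (w @ [l]))) {..length (w @ [l])}"
    unfolding eval_\<psi> by (simp only: comp_def)
  moreover have "range (\<psi> \<circ> y) \<subseteq> carrier H'"
    using H'(2) y(1) by (auto simp: iso_def hom_def)
  ultimately show ?case
    using H'(1) card by blast
qed

text \<open>The fibres of homomorphisms into members of \<open>V\<close> form a basis of
  neighbourhoods, since two homomorphisms combine into one to the direct product. Hence the closure
  can be tested on one homomorphism at a time.\<close>

lemma closure_iff:
  assumes "S \<subseteq> carrier G" "group G"
  shows "g \<in> pro_topology V G closure_of S \<longleftrightarrow>
    g \<in> carrier G \<and> (\<forall>H\<in>V. \<forall>\<phi>\<in>hom G H. \<phi> g \<in> \<phi> ` S)"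
proof -
  define B where "B = {{x \<in> carrier G. \<phi> x \<in> U} | \<phi> H U.
        H \<in> V \<and> \<phi> \<in> hom G H \<and> openin (discrete_topology (carrier H)) U}"
  have top: "pro_topology V G = topology_generated_by B"
    by (simp add: pro_topology_def B_def)
  \<comment> \<open>The homomorphism to a trivial group makes \<open>carrier G\<close> a subbasic
    open set, hence the whole space.\<close>
  define T :: "nat monoid" where "T = singleton_group 0"
  have T: "T \<in> V"
    unfolding T_def by (intro trivial_in_V) simp
  have T_hom: "(\<lambda>_. 0) \<in> hom G T"
    by (simp add: hom_def T_def singleton_group_def)
  have B_I: "{x \<in> carrier G. \<phi> x \<in> U} \<in> B" if "H \<in> V" "\<phi> \<in> hom G H" "U \<subseteq> carrier H" for \<phi> H U
    using that unfolding B_def by auto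
  have "{x \<in> carrier G. (\<lambda>_. 0) x \<in> carrier T} \<in> B"
    by (intro B_I[OF T T_hom]) simp
  then have "carrier G \<in> B"
    by (simp add: T_def)
  moreover have "\<Union>B \<subseteq> carrier G"
    by (auto simp: B_def)
  ultimately have space: "topspace (pro_topology V G) = carrier G"
    unfolding top topology_generated_by_topspace by blast
  have base: "\<exists>H\<in>V. \<exists>\<phi>\<in>hom G H. {x \<in> carrier G. \<phi> x = \<phi> g} \<subseteq> U"
    if g: "g \<in> carrier G" and "generate_topology_on B U" "g \<in> U" for U g
    using that(2,3)
  proof (induction rule: generate_topology_on.induct)
    case (Int U U')
    then have gU: "g \<in> U" "g \<in> U'"
      by auto
    obtain H \<phi> H' \<phi>' where *: "H \<in> V" "\<phi> \<in> hom G H" "{x \<in> carrier G. \<phi> x = \<phi> g} \<subseteq> U"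
      "H' \<in> V" "\<phi>' \<in> hom G H'" "{x \<in> carrier G. \<phi>' x = \<phi>' g} \<subseteq> U'"
      using Int.IH(1)[OF gU(1)] Int.IH(2)[OF gU(2)] by blast
    obtain K \<psi> where K: "K \<in> V" "\<psi> \<in> iso (H \<times>\<times> H') K"
      using in_class_DirProd[OF in_class_self[OF *(1)] in_class_self[OF *(4)]] in_V_group(1)[OF *(1)]
      unfolding in_class_def is_iso_def by blast
    define \<kappa> where "\<kappa> x = \<psi> (\<phi> x, \<phi>' x)" for x
    have "\<kappa> \<in> hom G K"
      using *(2,5) K(2) by (auto simp: \<kappa>_def hom_def iso_def Pi_iff)
    moreover have "{x \<in> carrier G. \<kappa> x = \<kappa> g} \<subseteq> U \<inter> U'"
    proof
      fix x assume "x \<in> {x \<in> carrier G. \<kappa> x = \<kappa> g}"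
      then have "x \<in> carrier G" "\<psi> (\<phi> x, \<phi>' x) = \<psi> (\<phi> g, \<phi>' g)"
        by (auto simp: \<kappa>_def)
      moreover have "(\<phi> x, \<phi>' x) \<in> carrier (H \<times>\<times> H')" "(\<phi> g, \<phi>' g) \<in> carrier (H \<times>\<times> H')"
        using *(2,5) g \<open>x \<in> carrier G\<close> by (auto simp: hom_def)
      ultimately have "\<phi> x = \<phi> g \<and> \<phi>' x = \<phi>' g"
        using K(2) unfolding iso_def bij_betw_def inj_on_def by blast
      then show "x \<in> U \<inter> U'"
        using *(3,6) \<open>x \<in> carrier G\<close> by blast
    qed
    ultimately show ?case
      using K(1) by blast
  next
    case (UN K)
    then show ?case by (meson Union_iff Union_upper subset_trans)
  next
    case (Basis U)
    then obtain \<phi> H U' where "H \<in> V" "\<phi> \<in> hom G H" "U = {x \<in> carrier G. \<phi> x \<in> U'}"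
      unfolding B_def by auto
    then show ?case
      using Basis(2) by (intro bexI[of _ H] bexI[of _ \<phi>]) auto
  qed auto
  show ?thesis
  proof (intro iffI conjI ballI)
    assume g: "g \<in> pro_topology V G closure_of S"
    then show gG: "g \<in> carrier G"
      using space by (auto simp: in_closure_of)
    fix H \<phi> assume H: "H \<in> V" "\<phi> \<in> hom G H"
    have "openin (pro_topology V G) {x \<in> carrier G. \<phi> x \<in> {\<phi> g}}"
      unfolding top using H gG by (intro topology_generated_by_Basis B_I) (auto simp: hom_def)
    moreover have "g \<in> {x \<in> carrier G. \<phi> x \<in> {\<phi> g}}"
      using gG by simp
    ultimately obtain y where "y \<in> S" "y \<in> {x \<in> carrier G. \<phi> x \<in> {\<phi> g}}"
      using g unfolding in_closure_of by meson
    then have "y \<in> S" "\<phi> y = \<phi> g"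
      by auto
    then show "\<phi> g \<in> \<phi> ` S"
      by (metis imageI)
  next
    assume g: "g \<in> carrier G \<and> (\<forall>H\<in>V. \<forall>\<phi>\<in>hom G H. \<phi> g \<in> \<phi> ` S)"
    have "\<exists>y\<in>S. y \<in> U" if U: "g \<in> U" "openin (pro_topology V G) U" for U
    proof -
      obtain H \<phi> where H: "H \<in> V" "\<phi> \<in> hom G H" "{x \<in> carrier G. \<phi> x = \<phi> g} \<subseteq> U"
        using base[of g U] g U unfolding top openin_topology_generated_by_iff by blast
      then obtain y where "y \<in> S" "\<phi> g = \<phi> y"
        using g by blast
      then show ?thesis
        using H(3) assms(1) by auto
    qed
    note open_meets = this
    show "g \<in> pro_topology V G closure_of S"
      unfolding in_closure_of space
    proof (intro conjI allI impI)
      show "\<exists>y. y \<in> S \<and> y \<in> T" if "g \<in> T \<and> openin (pro_topology V G) T" for T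
        using open_meets[of T] that by blast
    qed (use g in simp)
  qed
qed

end

section \<open>Closures of cyclic subgroups\<close>

locale root_data = group F for F :: "('a, 'm) monoid_scheme" (structure) +
  fixes u w :: 'a and e :: nat
  assumes u: "u \<in> carrier F" and e_pos: "e > 0" and w: "w = u [^] e"
    and centralizer: "\<And>x. x \<in> carrier F \<Longrightarrow> x \<otimes> w = w \<otimes> x \<Longrightarrow> \<exists>k::int. x = u [^] k"
    and order: "\<And>n::nat. u [^] n = \<one> \<Longrightarrow> n = 0"
begin

lemma w_closed [simp]: "w \<in> carrier F"
  by (simp add: w u)

lemma u_int_pow_inj:
  assumes "u [^] k = u [^] (l::int)"
  shows "k = l"
proof -
  have "ord u = 0"
    using order pow_ord_eq_1[OF u] by blast
  then show ?thesis
    using assms int_pow_eq[OF u, of k l] by simp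
qed

lemma w_int_pow: "w [^] (t::int) = u [^] (int e * t)"
  using u by (simp add: w int_pow_pow flip: int_pow_int)

lemma root_is_power:
  assumes "v \<in> carrier F" "v [^] (k::nat) = w"
  obtains a where "v = u [^] (a::int)" "int e = a * int k"
proof -
  have "v \<otimes> w = w \<otimes> v"
    using assms nat_pow_Suc2[of v k] by (metis nat_pow_Suc)
  from centralizer[OF assms(1) this] obtain a :: int where a: "v = u [^] a" ..
  have "u [^] (a * int k) = u [^] int e"
    using assms(2) u by (simp add: a w int_pow_int flip: int_pow_pow)
  then have "int e = a * int k"
    using u_int_pow_inj by metis
  then show thesis
    using that a by blast
qed

end

locale free_group_pseudovariety = free_group F X + extension_closed_pseudovariety V
  for F :: "('a, 'm) monoid_scheme" (structure) and X and V +
  assumes nontrivial: "nontrivial_class V"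
begin

text \<open>For the reduced word of \<open>g\<close>, the empty prefix and the whole word have
  different values under an assignment of the generators, and freeness turns the assignment into a
  homomorphism.\<close>

lemma separate:
  assumes "prime p" "in_class (integer_mod_group p) V" "g \<in> carrier F" "g \<noteq> \<one>"
  obtains H \<phi> k where "H \<in> V" "\<phi> \<in> hom F H" "card (carrier H) = p ^ k" "\<phi> g \<noteq> \<one>\<^bsub>H\<^esub>"
proof -
  obtain q where q: "q \<in> words_over X" "reduced q" "eval q = g"
    using reduced_word_exists[OF assms(3)] .
  have "q \<noteq> []"
    using q assms(4) by auto
  from separate_prefixes[OF assms(1,2) q(2)] obtain H where H: "H \<in> V"
    and ex: "\<exists>k x. card (carrier H) = p ^ k \<and> range x \<subseteq> carrier H \<and>
      inj_on (\<lambda>n. word_eval H x (take n q)) {..length q}" ..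
  from ex obtain k where "\<exists>x. card (carrier H) = p ^ k \<and> range x \<subseteq> carrier H \<and>
      inj_on (\<lambda>n. word_eval H x (take n q)) {..length q}" ..
  then obtain x where kx: "card (carrier H) = p ^ k \<and> range x \<subseteq> carrier H \<and>
      inj_on (\<lambda>n. word_eval H x (take n q)) {..length q}" ..
  note k = kx[THEN conjunct1] and x = kx[THEN conjunct2, THEN conjunct1]
    and inj = kx[THEN conjunct2, THEN conjunct2]
  have "x \<in> X \<rightarrow> carrier H"
    using x by auto
  from extend_hom[OF in_V_group(1)[OF H] this] obtain \<phi> where
    \<phi>: "\<phi> \<in> hom F H" "\<forall>p. p \<in> words_over X \<longrightarrow> reduced p \<longrightarrow> \<phi> (eval p) = word_eval H x p"
    by blast
  have "word_eval H x q \<noteq> \<one>\<^bsub>H\<^esub>"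
    using inj_onD[OF inj, of 0 "length q"] \<open>q \<noteq> []\<close> by auto
  moreover have "\<phi> g = word_eval H x q"
    using \<phi>(2) q by blast
  ultimately show thesis
    using that[OF H \<phi>(1) k] by simp
qed

lemma separate':
  assumes "g \<in> carrier F" "g \<noteq> \<one>"
  obtains H \<phi> where "H \<in> V" "\<phi> \<in> hom F H" "\<phi> g \<noteq> \<one>\<^bsub>H\<^esub>"
proof -
  obtain p where "prime p" "in_class (integer_mod_group p) V"
    using prime_cyclic_in_class[OF nontrivial] .
  from separate[OF this assms] show thesis
    using that by blast
qed

lemma hom_group_hom: "H \<in> V \<Longrightarrow> \<phi> \<in> hom F H \<Longrightarrow> group_hom F H \<phi>"
  using in_V_group(1) by (simp add: group_hom_def group_hom_axioms_def)

lemma generate_one: "generate F {\<one>} = {\<one>}"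
  by (auto simp: generate_pow)

lemma closure_one: "pro_topology V F closure_of generate F {\<one>} = generate F {\<one>}"
proof -
  have "g = \<one>" if g: "g \<in> pro_topology V F closure_of {\<one>}" for g
  proof (rule ccontr)
    assume "g \<noteq> \<one>"
    moreover have cl: "g \<in> carrier F" "\<forall>H\<in>V. \<forall>\<phi>\<in>hom F H. \<phi> g \<in> \<phi> ` {\<one>}"
      using g closure_iff[of "{\<one>}" F g] is_group by auto
    ultimately obtain H \<phi> where H: "H \<in> V" "\<phi> \<in> hom F H" "\<phi> g \<noteq> \<one>\<^bsub>H\<^esub>"
      using separate' by blast
    interpret group_hom F H \<phi>
      using H by (intro hom_group_hom)
    have "\<phi> g \<in> \<phi> ` {\<one>}"
      using cl(2) H(1,2) by blast
    then show False
      using H(3) by simp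
  qed
  moreover have "\<one> \<in> pro_topology V F closure_of {\<one>}"
    using closure_iff[of "{\<one>}" F \<one>] is_group by auto
  ultimately show ?thesis
    unfolding generate_one by blast
qed

end

locale free_group_root = free_group_pseudovariety F X V + root_data F u w e
  for F :: "('a, 'm) monoid_scheme" (structure) and X V u w e
begin

definition cyclic_divisors :: "nat set" where
  "cyclic_divisors = {k. 1 \<le> k \<and> k dvd e \<and> in_class (integer_mod_group k) V}"

definition m :: nat where
  "m = Max cyclic_divisors"

lemma finite_cyclic_divisors: "finite cyclic_divisors"
  using e_pos by (intro finite_subset[of cyclic_divisors "{..e}"]) (auto simp: cyclic_divisors_def dvd_imp_le)

lemma m_in_cyclic_divisors: "m \<in> cyclic_divisors"
  unfolding m_def using in_class_cyclic_1
  by (intro Max_in finite_cyclic_divisors) (auto simp: cyclic_divisors_def intro!: exI[of _ 1])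

lemma m_pos: "m > 0" and m_dvd_e: "m dvd e" and m_in_class: "in_class (integer_mod_group m) V"
  using m_in_cyclic_divisors by (auto simp: cyclic_divisors_def)

text \<open>\<open>lcm k m\<close> divides \<open>e\<close>, and its cyclic group is a quotient of
  the one of order \<open>k * m\<close>. So it belongs to \<open>cyclic_divisors\<close> and cannot
  exceed the maximum \<open>m\<close>.\<close>

lemma dvd_m:
  assumes "k \<in> cyclic_divisors"
  shows "k dvd m"
proof -
  have k: "k > 0" "k dvd e" "in_class (integer_mod_group k) V"
    using assms by (auto simp: cyclic_divisors_def)
  have "in_class (integer_mod_group (lcm k m)) V"
    using k m_pos by (intro in_class_cyclic_dvd[OF in_class_cyclic_mult[OF k(3) m_in_class]]) (auto intro: lcm_least)
  then have "lcm k m \<in> cyclic_divisors"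
    using k m_pos m_dvd_e lcm_pos_nat[of k m] unfolding cyclic_divisors_def by (auto simp: Suc_le_eq)
  then have "lcm k m \<le> m"
    unfolding m_def using finite_cyclic_divisors by simp
  then have "lcm k m = m"
    using m_pos by (intro antisym dvd_imp_le[OF dvd_lcm2 lcm_pos_nat]) (use k in auto)
  then show ?thesis
    by (metis dvd_lcm1)
qed

text \<open>If \<open>g\<close> did not commute with \<open>w\<close>, some homomorphism to a member
  of \<open>V\<close> would detect this; but there the image of \<open>g\<close> is a power of the
  image of \<open>w\<close>.\<close>

lemma in_closure_imp_power:
  assumes g: "g \<in> pro_topology V F closure_of generate F {w}"
  obtains k :: int where "g = u [^] k"
proof -
  have gen: "generate F {w} \<subseteq> carrier F"
    by (auto simp: generate_pow)
  have gF: "g \<in> carrier F" and gw: "\<forall>H\<in>V. \<forall>\<phi>\<in>hom F H. \<phi> g \<in> \<phi> ` generate F {w}"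
    using g closure_iff[OF gen is_group] by auto
  have "g \<otimes> w = w \<otimes> g"
  proof (rule ccontr)
    assume *: "g \<otimes> w \<noteq> w \<otimes> g"
    define c where "c = (g \<otimes> w) \<otimes> inv (w \<otimes> g)"
    have "c \<in> carrier F" "c \<noteq> \<one>"
      using * gF inv_solve_right[of \<one> "g \<otimes> w" "w \<otimes> g"] by (auto simp: c_def)
    then obtain H \<phi> where H: "H \<in> V" "\<phi> \<in> hom F H" "\<phi> c \<noteq> \<one>\<^bsub>H\<^esub>"
      using separate' by blast
    interpret \<phi>: group_hom F H \<phi>
      using H by (intro hom_group_hom)
    have "\<phi> g \<in> \<phi> ` generate F {w}"
      using gw H(1,2) by blast
    then obtain t :: int where t: "\<phi> g = \<phi> (w [^] t)"
      by (auto simp: generate_pow)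
    have "w [^] t \<otimes> w = w \<otimes> w [^] t"
      using int_pow_mult[of w t 1] int_pow_mult[of w 1 t] by (simp add: add.commute int_pow_1)
    then have "\<phi> (g \<otimes> w) = \<phi> (w \<otimes> g)"
      using gF t by (metis \<phi>.hom_mult int_pow_closed w_closed)
    then have "\<phi> c = \<one>\<^bsub>H\<^esub>"
      using gF unfolding c_def by (metis \<phi>.H.r_inv \<phi>.hom_closed \<phi>.hom_inv \<phi>.hom_mult inv_closed m_closed w_closed)
    then show False
      using H by simp
  qed
  from centralizer[OF gF this] show thesis
    using that by blast
qed

text \<open>Otherwise some prime power \<open>q ^ j\<close> divides \<open>m\<close> but not
  \<open>k\<close>. In a \<open>q\<close>-group where the image of
  \<open>u [^] (q ^ (j - 1))\<close> is nontrivial, the image of \<open>u\<close> has order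
  divisible by \<open>q ^ j\<close>. As \<open>q ^ j\<close> also divides \<open>e\<close>, it
  divides the exponents of all powers of \<open>u\<close> whose images are powers of the image of
  \<open>w\<close>.\<close>

lemma in_closure_imp_dvd:
  assumes g: "u [^] (k::int) \<in> pro_topology V F closure_of generate F {w}"
  shows "int m dvd k"
proof (rule ccontr)
  assume ndvd: "\<not> int m dvd k"
  have gen: "generate F {w} \<subseteq> carrier F"
    by (auto simp: generate_pow)
  have gw: "\<forall>H\<in>V. \<forall>\<phi>\<in>hom F H. \<phi> (u [^] k) \<in> \<phi> ` generate F {w}"
    using g closure_iff[OF gen is_group] by auto
  define k' where "k' = nat \<bar>k\<bar>"
  have k': "int d dvd k \<longleftrightarrow> d dvd k'" for d
    unfolding k'_def by (metis dvd_abs_iff int_dvd_int_iff abs_ge_zero nat_0_le)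
  have "k' \<noteq> 0"
    using ndvd by (auto simp: k'_def)
  obtain q where q: "prime q" "multiplicity q m > multiplicity q k'"
    using multiplicity_le_imp_dvd[of m k'] ndvd k' m_pos by (metis not_le not_gr_zero)
  define j where "j = multiplicity q m"
  have j: "q ^ j dvd m" "\<not> q ^ j dvd k'" "j > 0"
  proof -
    show "q ^ j dvd m"
      unfolding j_def by (rule multiplicity_dvd)
    show "\<not> q ^ j dvd k'"
      using q \<open>k' \<noteq> 0\<close> prime_gt_1_nat[OF q(1)] by (simp add: j_def power_dvd_iff_le_multiplicity)
    show "j > 0"
      using q(2) by (simp add: j_def)
  qed
  have "q dvd m"
    using j(1,3) by (metis dvd_power dvd_trans)
  then have Cq: "in_class (integer_mod_group q) V"
    using in_class_cyclic_dvd[OF m_in_class] m_pos by blast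
  have "u [^] (q ^ (j - 1)) \<noteq> \<one>"
    using order[of "q ^ (j - 1)"] prime_gt_0_nat[OF q(1)] by auto
  then obtain H \<phi> s where H: "H \<in> V" "\<phi> \<in> hom F H" "card (carrier H) = q ^ s"
    "\<phi> (u [^] (q ^ (j - 1))) \<noteq> \<one>\<^bsub>H\<^esub>"
    using separate[OF q(1) Cq] u by (metis nat_pow_closed)
  interpret \<phi>: group_hom F H \<phi>
    using H by (intro hom_group_hom)
  have pu: "\<phi> u \<in> carrier H"
    using u by simp
  define n where "n = \<phi>.H.ord (\<phi> u)"
  have "n dvd q ^ s"
    using \<phi>.H.ord_dvd_group_order[OF pu] H(3) by (simp add: n_def order_def)
  then obtain i where i: "n = q ^ i"
    using divides_primepow_nat[OF q(1)] by blast
  have "\<not> q ^ i dvd q ^ (j - 1)"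
    using H(4) u pu \<phi>.H.pow_eq_id[OF pu] by (simp add: \<phi>.hom_nat_pow i[symmetric] n_def)
  then have "j \<le> i"
    by (metis Suc_pred' j(3) le_imp_power_dvd not_less_eq_eq)
  then have "q ^ j dvd n"
    by (simp add: i le_imp_power_dvd)
  have "\<phi> (u [^] k) \<in> \<phi> ` generate F {w}"
    using gw H(1,2) by blast
  then obtain t :: int where t: "\<phi> (u [^] k) = \<phi> (w [^] t)"
    by (auto simp: generate_pow)
  then have "\<phi> u [^]\<^bsub>H\<^esub> k = \<phi> u [^]\<^bsub>H\<^esub> (int e * t)"
    using u by (simp add: w_int_pow \<phi>.hom_int_pow)
  then have "int n dvd int e * t - k"
    using \<phi>.H.int_pow_eq[OF pu] by (simp add: n_def)
  moreover have "int (q ^ j) dvd int n"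
    using \<open>q ^ j dvd n\<close> by (simp only: int_dvd_int_iff)
  ultimately have "int (q ^ j) dvd int e * t - k"
    by (rule dvd_trans[rotated])
  moreover have "int (q ^ j) dvd int e * t"
    using j(1) m_dvd_e by (intro dvd_mult2) (meson dvd_trans int_dvd_int_iff)
  ultimately have "int (q ^ j) dvd k"
    by (metis dvd_diff_right_iff)
  then show False
    using j(2) k' by blast
qed

text \<open>In a member of \<open>V\<close> the image of \<open>u\<close> has an order
  \<open>n\<close> whose cyclic group is in the class, so \<open>gcd e n\<close> divides
  \<open>m\<close>. By Bezout, \<open>m * t\<close> is congruent modulo \<open>n\<close> to a
  multiple of \<open>e\<close>.\<close>

lemma power_in_closure: "u [^] (int m * t) \<in> pro_topology V F closure_of generate F {w}"
proof -
  have gen: "generate F {w} \<subseteq> carrier F"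
    by (auto simp: generate_pow)
  have "\<phi> (u [^] (int m * t)) \<in> \<phi> ` generate F {w}" if H: "H \<in> V" "\<phi> \<in> hom F H" for H \<phi>
  proof -
    interpret \<phi>: group_hom F H \<phi>
      using H by (intro hom_group_hom)
    have pu: "\<phi> u \<in> carrier H"
      using u by simp
    define n where "n = \<phi>.H.ord (\<phi> u)"
    have n: "in_class (integer_mod_group n) V" "n > 0"
      using in_class_cyclic_ord[OF in_class_self[OF H(1)] \<phi>.H.is_group pu] by (auto simp: n_def)
    have "gcd e n \<in> cyclic_divisors"
      using in_class_cyclic_dvd[OF n(1) _ n(2), of "gcd e n"] n(2) by (auto simp: cyclic_divisors_def Suc_le_eq)
    then have "gcd e n dvd m"
      by (rule dvd_m)
    then obtain c where c: "m = gcd e n * c" ..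
    obtain a b where ab: "a * int e + b * int n = gcd (int e) (int n)"
      using bezout_int by blast
    have "int m * t = (a * int e + b * int n) * (int c * t)"
      unfolding ab by (simp add: c)
    then have "int m * t - int e * (a * int c * t) = int n * (b * int c * t)"
      by (simp add: algebra_simps)
    then have "int n dvd int m * t - int e * (a * int c * t)"
      by simp
    then have "\<phi> u [^]\<^bsub>H\<^esub> (int e * (a * int c * t)) = \<phi> u [^]\<^bsub>H\<^esub> (int m * t)"
      using \<phi>.H.int_pow_eq[OF pu] by (simp add: n_def)
    then have "\<phi> (u [^] (int m * t)) = \<phi> (w [^] (a * int c * t))"
      using u by (simp add: w_int_pow \<phi>.hom_int_pow)
    then show ?thesis
      by (auto simp: generate_pow)
  qed
  then show ?thesis
    using closure_iff[OF gen is_group] u by simp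
qed

lemma generate_u_pow: "generate F {u [^] (n::nat)} = {u [^] (int n * t) | t. True}"
  using u by (auto simp: generate_pow int_pow_pow simp flip: int_pow_int)

lemma closure_cyclic: "pro_topology V F closure_of generate F {w} = generate F {u [^] m}"
proof
  show "pro_topology V F closure_of generate F {w} \<subseteq> generate F {u [^] m}"
  proof
    fix g assume g: "g \<in> pro_topology V F closure_of generate F {w}"
    then obtain k :: int where k: "g = u [^] k"
      using in_closure_imp_power by blast
    have "int m dvd k"
      using in_closure_imp_dvd g unfolding k .
    then show "g \<in> generate F {u [^] m}"
      unfolding generate_u_pow k by (auto elim!: dvdE)
  qed
  show "generate F {u [^] m} \<subseteq> pro_topology V F closure_of generate F {w}"
    unfolding generate_u_pow using power_in_closure by auto
qed

lemma closure_subgroup: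
  "subgroup (pro_topology V F closure_of generate F {w}) (F\<lparr>carrier := generate F {u}\<rparr>)"
proof -
  have "generate F {u [^] m} \<subseteq> generate F {u}"
    using generate_u_pow[of m] generate_u_pow[of 1] u by auto
  moreover have "subgroup (generate F {u [^] m}) F" "subgroup (generate F {u}) F"
    using u by (auto intro!: generate_is_subgroup)
  ultimately show ?thesis
    unfolding closure_cyclic using subgroup_incl by blast
qed

text \<open>As \<open>u\<close> has infinite order and \<open>m\<close> divides \<open>e\<close>,
  the subgroup equals its closure only if \<open>m = e\<close>.\<close>

lemma closed_iff: "closedin (pro_topology V F) (generate F {w}) \<longleftrightarrow> in_class (integer_mod_group e) V"
proof -
  have "closedin (pro_topology V F) (generate F {w}) \<longleftrightarrow>
      pro_topology V F closure_of generate F {w} = generate F {w}"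
    by (simp only: closure_of_eq)
  also have "\<dots> \<longleftrightarrow> generate F {u [^] m} = generate F {u [^] e}"
    by (simp only: closure_cyclic) (simp only: w)
  also have "\<dots> \<longleftrightarrow> m = e"
  proof
    assume "generate F {u [^] m} = generate F {u [^] e}"
    then have "u [^] (int m * 1) \<in> generate F {u [^] e}"
      unfolding generate_u_pow by blast
    then obtain t where "u [^] (int m * 1) = u [^] (int e * t)"
      unfolding generate_u_pow by blast
    then have "int m * 1 = int e * t"
      by (rule u_int_pow_inj)
    then have "int e dvd int m"
      by simp
    then show "m = e"
      using m_dvd_e by (simp add: dvd_antisym)
  qed simp
  also have "\<dots> \<longleftrightarrow> in_class (integer_mod_group e) V"
  proof
    assume "in_class (integer_mod_group e) V"
    then have "e \<in> cyclic_divisors"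
      using e_pos by (simp add: cyclic_divisors_def)
    then show "m = e"
      using dvd_m m_dvd_e dvd_antisym by blast
  qed (use m_in_class in auto)
  finally show ?thesis .
qed

text \<open>Otherwise \<open>m * d\<close> would be in \<open>cyclic_divisors\<close>. Consequently
  \<open>u [^] m\<close>, whose power with exponent \<open>e div m\<close> is \<open>w\<close>,
  passes the test of the algorithm.\<close>

lemma cofactor_free:
  assumes "d dvd e div m" "d \<ge> 2"
  shows "\<not> in_class (integer_mod_group d) V"
proof
  assume "in_class (integer_mod_group d) V"
  then have "in_class (integer_mod_group (m * d)) V"
    using in_class_cyclic_mult m_in_class m_pos assms(2) by simp
  moreover have "m * d dvd e"
    using assms(1) m_dvd_e by (metis dvd_mult_div_cancel mult_dvd_mono dvd_refl)
  ultimately have "m * d \<in> cyclic_divisors"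
    using m_pos assms(2) by (simp add: cyclic_divisors_def)
  then have "m * d \<le> m"
    unfolding m_def using finite_cyclic_divisors by simp
  then show False
    using m_pos assms(2) by simp
qed

text \<open>This certifies the result of the search. The cyclic group of order
  \<open>gcd k m\<close> is in the class, so \<open>k\<close> is coprime to \<open>m\<close>; as
  \<open>k\<close> divides \<open>e\<close>, it divides \<open>e div m\<close>, and the lower bound
  gives equality.\<close>

lemma maximal_root:
  assumes "q \<in> carrier F" "q [^] k = w" and free: "\<And>d. d dvd k \<Longrightarrow> d \<ge> 2 \<Longrightarrow> \<not> in_class (integer_mod_group d) V"
    and "e div m \<le> k"
  shows "q = u [^] m"
proof -
  obtain a where a: "q = u [^] (a::int)" "int e = a * int k"
    using root_is_power[OF assms(1,2)] .
  have "k dvd e"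
    using a(2) by (metis dvd_triv_right int_dvd_int_iff)
  then have "k > 0"
    using e_pos by (auto intro: Nat.gr0I)
  have "coprime k m"
  proof (rule ccontr)
    assume "\<not> coprime k m"
    then have "gcd k m \<noteq> 1"
      by (simp add: coprime_iff_gcd_eq_1)
    moreover have "gcd k m > 0"
      using m_pos by simp
    ultimately have "gcd k m \<ge> 2"
      by linarith
    moreover have "in_class (integer_mod_group (gcd k m)) V"
      using in_class_cyclic_dvd[OF m_in_class _ m_pos] by simp
    ultimately show False
      using free[of "gcd k m"] by simp
  qed
  moreover have "k dvd m * (e div m)"
    using \<open>k dvd e\<close> m_dvd_e by simp
  ultimately have "k dvd e div m"
    by (simp add: coprime_dvd_mult_right_iff)
  then have "k \<le> e div m"
    using e_pos m_dvd_e m_pos by (intro dvd_imp_le) (auto simp: dvd_imp_le div_greater_zero_iff)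
  then have "e = m * k"
    using assms(4) m_dvd_e by simp
  then have "a * int k = int m * int k"
    using a(2) by (metis of_nat_mult)
  then have "a = int m"
    using \<open>k > 0\<close> by simp
  then show ?thesis
    using a(1) by (simp add: int_pow_int)
qed

end

section \<open>Recursive functions on words\<close>

text \<open>A \<open>recursive_fun\<close> has definite values on lists of any length. Asking for
  agreement only at length \<open>n\<close> permits expressions such as \<open>xs ! 0\<close>
  whatever their values elsewhere.\<close>

definition computes :: "nat \<Rightarrow> (nat list \<Rightarrow> nat) \<Rightarrow> bool" where
  "computes n f \<longleftrightarrow> (\<exists>f'. recursive_fun n f' \<and> (\<forall>xs. length xs = n \<longrightarrow> f' xs = f xs))"

lemma computes_cong:
  assumes "computes n f" "\<And>xs. length xs = n \<Longrightarrow> f xs = g xs"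
  shows "computes n g"
  using assms unfolding computes_def by metis

lemma computes_proj: "i < n \<Longrightarrow> computes n (\<lambda>xs. xs ! i)"
  unfolding computes_def using recursive_fun.proj by blast

lemma computes_comp:
  assumes f: "computes (length gs) f" and gs: "\<And>g. g \<in> set gs \<Longrightarrow> computes n g"
  shows "computes n (\<lambda>xs. f (map (\<lambda>g. g xs) gs))"
proof -
  obtain f' where f': "recursive_fun (length gs) f'" "\<And>xs. length xs = length gs \<Longrightarrow> f' xs = f xs"
    using f unfolding computes_def by blast
  obtain c where c: "\<And>g. g \<in> set gs \<Longrightarrow> recursive_fun n (c g) \<and> (\<forall>xs. length xs = n \<longrightarrow> c g xs = g xs)"
    using gs unfolding computes_def by metis
  have "recursive_fun n (\<lambda>xs. f' (map (\<lambda>g. g xs) (map c gs)))"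
    using f'(1) c by (intro recursive_fun.comp) auto
  moreover have "f' (map (\<lambda>g. g xs) (map c gs)) = f (map (\<lambda>g. g xs) gs)" if "length xs = n" for xs
  proof -
    have "map (\<lambda>g. g xs) (map c gs) = map (\<lambda>g. g xs) gs"
      using c that by simp
    then show ?thesis
      by (simp only: f'(2) length_map)
  qed
  ultimately show ?thesis
    unfolding computes_def by blast
qed

section \<open>Composition, recursion and minimization for fixed numbers of arguments\<close>

lemma computes_comp1:
  assumes "computes 1 (\<lambda>xs. f (xs ! 0))" "computes n a"
  shows "computes n (\<lambda>xs. f (a xs))"
  using computes_comp[of "[a]" "\<lambda>xs. f (xs ! 0)" n] assms by simp

lemma computes_comp2:
  assumes "computes 2 (\<lambda>xs. f (xs ! 0) (xs ! 1))" "computes n a" "computes n b"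
  shows "computes n (\<lambda>xs. f (a xs) (b xs))"
proof -
  have len: "length [a, b] = 2"
    by simp
  have "\<forall>g\<in>set [a, b]. computes n g"
    using assms(2-) by simp
  then have "computes n (\<lambda>xs. (\<lambda>xs. f (xs ! 0) (xs ! 1)) (map (\<lambda>g. g xs) [a, b]))"
    using assms(1) by (intro computes_comp) (simp_all only: len)
  then show ?thesis
    by simp
qed

lemma computes_comp3:
  assumes "computes 3 (\<lambda>xs. f (xs ! 0) (xs ! 1) (xs ! 2))" "computes n a" "computes n b" "computes n c"
  shows "computes n (\<lambda>xs. f (a xs) (b xs) (c xs))"
proof -
  have len: "length [a, b, c] = 3"
    by simp
  have "\<forall>g\<in>set [a, b, c]. computes n g"
    using assms(2-) by simp
  then have "computes n (\<lambda>xs. (\<lambda>xs. f (xs ! 0) (xs ! 1) (xs ! 2)) (map (\<lambda>g. g xs) [a, b, c]))"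
    using assms(1) by (intro computes_comp) (simp_all only: len)
  then show ?thesis
    by simp
qed

lemma computes_comp4:
  assumes "computes 4 (\<lambda>xs. f (xs ! 0) (xs ! 1) (xs ! 2) (xs ! 3))"
    and "computes n a" "computes n b" "computes n c" "computes n d"
  shows "computes n (\<lambda>xs. f (a xs) (b xs) (c xs) (d xs))"
proof -
  have len: "length [a, b, c, d] = 4"
    by simp
  have "\<forall>g\<in>set [a, b, c, d]. computes n g"
    using assms(2-) by simp
  then have "computes n (\<lambda>xs. (\<lambda>xs. f (xs ! 0) (xs ! 1) (xs ! 2) (xs ! 3)) (map (\<lambda>g. g xs) [a, b, c, d]))"
    using assms(1) by (intro computes_comp) (simp_all only: len)
  then show ?thesis
    by simp
qed

lemma computes_Suc: "computes n f \<Longrightarrow> computes n (\<lambda>xs. Suc (f xs))"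
  by (rule computes_comp1[of Suc]) (use recursive_fun.succ in \<open>auto simp: computes_def\<close>)

lemma computes_const: "computes n (\<lambda>xs. k)"
proof (induction k)
  case 0
  then show ?case
    unfolding computes_def using recursive_fun.zero by blast
qed (rule computes_Suc)

lemma tl_nth: "xs \<noteq> [] \<Longrightarrow> tl xs ! i = xs ! Suc i"
  by (cases xs) auto

lemma computes_rec_aux:
  assumes "computes n a" "computes (n + 2) s"
  shows "computes (n + 1) (\<lambda>xs. rec_nat (a (tl xs)) (\<lambda>k r. s (k # r # tl xs)) (xs ! 0))"
proof -
  obtain a' s' where *: "recursive_fun n a'" "\<And>xs. length xs = n \<Longrightarrow> a' xs = a xs"
    "recursive_fun (n + 2) s'" "\<And>xs. length xs = n + 2 \<Longrightarrow> s' xs = s xs"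
    using assms unfolding computes_def by blast
  have "rec_nat (a' (tl xs)) (\<lambda>k r. s' (k # r # tl xs)) m = rec_nat (a (tl xs)) (\<lambda>k r. s (k # r # tl xs)) m"
    if "length xs = n + 1" for xs m
    using that by (induction m) (simp_all add: *)
  moreover have "hd xs = xs ! 0" if "length xs = n + 1" for xs :: "nat list"
    using that by (cases xs) auto
  ultimately show ?thesis
    unfolding computes_def using recursive_fun.prim_rec[OF *(1,3)]
    by (intro exI[of _ "\<lambda>xs. rec_nat (a' (tl xs)) (\<lambda>k r. s' (k # r # tl xs)) (hd xs)"]) simp
qed

lemma computes_rec1:
  assumes "computes 2 (\<lambda>xs. s (xs ! 0) (xs ! 1))"
  shows "computes 1 (\<lambda>xs. rec_nat a s (xs ! 0))"
proof -
  have "computes (0 + 1) (\<lambda>xs. rec_nat ((\<lambda>_. a) (tl xs)) (\<lambda>k r. (\<lambda>xs. s (xs ! 0) (xs ! 1)) (k # r # tl xs)) (xs ! 0))"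
    by (rule computes_rec_aux) (simp_all only: computes_const add_0 assms)
  then show ?thesis
    by simp
qed

lemma computes_rec2:
  assumes "computes 1 (\<lambda>xs. a (xs ! 0))" "computes 3 (\<lambda>xs. s (xs ! 0) (xs ! 1) (xs ! 2))"
  shows "computes 2 (\<lambda>xs. rec_nat (a (xs ! 1)) (\<lambda>k r. s k r (xs ! 1)) (xs ! 0))"
proof -
  have "1 + 2 = (3 :: nat)" "1 + 1 = (2 :: nat)"
    by simp_all
  then have "computes 2 (\<lambda>xs. rec_nat ((\<lambda>xs. a (xs ! 0)) (tl xs))
      (\<lambda>k r. (\<lambda>xs. s (xs ! 0) (xs ! 1) (xs ! 2)) (k # r # tl xs)) (xs ! 0))"
    using computes_rec_aux[OF assms(1), of "\<lambda>xs. s (xs ! 0) (xs ! 1) (xs ! 2)"] assms(2) by metis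
  then show ?thesis
  proof (rule computes_cong)
    fix xs :: "nat list" assume "length xs = 2"
    then have "xs \<noteq> []"
      by auto
    then show "rec_nat ((\<lambda>xs. a (xs ! 0)) (tl xs)) (\<lambda>k r. (\<lambda>xs. s (xs ! 0) (xs ! 1) (xs ! 2)) (k # r # tl xs)) (xs ! 0) =
        rec_nat (a (xs ! 1)) (\<lambda>k r. s k r (xs ! 1)) (xs ! 0)"
      by (simp add: tl_nth numeral_eq_Suc)
  qed
qed

lemma computes_rec3:
  assumes "computes 2 (\<lambda>xs. a (xs ! 0) (xs ! 1))" "computes 4 (\<lambda>xs. s (xs ! 0) (xs ! 1) (xs ! 2) (xs ! 3))"
  shows "computes 3 (\<lambda>xs. rec_nat (a (xs ! 1) (xs ! 2)) (\<lambda>k r. s k r (xs ! 1) (xs ! 2)) (xs ! 0))"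
proof -
  have "2 + 2 = (4 :: nat)" "2 + 1 = (3 :: nat)"
    by simp_all
  then have "computes 3 (\<lambda>xs. rec_nat ((\<lambda>xs. a (xs ! 0) (xs ! 1)) (tl xs))
      (\<lambda>k r. (\<lambda>xs. s (xs ! 0) (xs ! 1) (xs ! 2) (xs ! 3)) (k # r # tl xs)) (xs ! 0))"
    using computes_rec_aux[OF assms(1), of "\<lambda>xs. s (xs ! 0) (xs ! 1) (xs ! 2) (xs ! 3)"] assms(2) by metis
  then show ?thesis
  proof (rule computes_cong)
    fix xs :: "nat list" assume "length xs = 3"
    then have "xs \<noteq> []"
      by auto
    then show "rec_nat ((\<lambda>xs. a (xs ! 0) (xs ! 1)) (tl xs)) (\<lambda>k r. (\<lambda>xs. s (xs ! 0) (xs ! 1) (xs ! 2) (xs ! 3)) (k # r # tl xs)) (xs ! 0) =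
        rec_nat (a (xs ! 1) (xs ! 2)) (\<lambda>k r. s k r (xs ! 1) (xs ! 2)) (xs ! 0)"
      by (simp add: tl_nth numeral_eq_Suc)
  qed
qed

lemma computes_rec4:
  assumes "computes 3 (\<lambda>xs. a (xs ! 0) (xs ! 1) (xs ! 2))" "computes 5 (\<lambda>xs. s (xs ! 0) (xs ! 1) (xs ! 2) (xs ! 3) (xs ! 4))"
  shows "computes 4 (\<lambda>xs. rec_nat (a (xs ! 1) (xs ! 2) (xs ! 3)) (\<lambda>k r. s k r (xs ! 1) (xs ! 2) (xs ! 3)) (xs ! 0))"
proof -
  have "3 + 2 = (5 :: nat)" "3 + 1 = (4 :: nat)"
    by simp_all
  then have "computes 4 (\<lambda>xs. rec_nat ((\<lambda>xs. a (xs ! 0) (xs ! 1) (xs ! 2)) (tl xs))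
      (\<lambda>k r. (\<lambda>xs. s (xs ! 0) (xs ! 1) (xs ! 2) (xs ! 3) (xs ! 4)) (k # r # tl xs)) (xs ! 0))"
    using computes_rec_aux[OF assms(1), of "\<lambda>xs. s (xs ! 0) (xs ! 1) (xs ! 2) (xs ! 3) (xs ! 4)"] assms(2) by metis
  then show ?thesis
  proof (rule computes_cong)
    fix xs :: "nat list" assume "length xs = 4"
    then have "xs \<noteq> []"
      by auto
    then show "rec_nat ((\<lambda>xs. a (xs ! 0) (xs ! 1) (xs ! 2)) (tl xs)) (\<lambda>k r. (\<lambda>xs. s (xs ! 0) (xs ! 1) (xs ! 2) (xs ! 3) (xs ! 4)) (k # r # tl xs)) (xs ! 0) =
        rec_nat (a (xs ! 1) (xs ! 2) (xs ! 3)) (\<lambda>k r. s k r (xs ! 1) (xs ! 2) (xs ! 3)) (xs ! 0)"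
      by (simp add: tl_nth numeral_eq_Suc)
  qed
qed

lemma computes_least_aux:
  assumes "computes (n + 1) f" "\<And>xs. length xs = n \<Longrightarrow> \<exists>y. f (y # xs) = 0"
  shows "computes n (\<lambda>xs. LEAST y. f (y # xs) = 0)"
proof -
  obtain f' where f': "recursive_fun (n + 1) f'" "\<And>xs. length xs = n + 1 \<Longrightarrow> f' xs = f xs"
    using assms unfolding computes_def by blast
  have "recursive_fun n (\<lambda>xs. LEAST y. f' (y # xs) = 0)"
    using f' assms(2) by (intro recursive_fun.minimize) auto
  then show ?thesis
    unfolding computes_def using f'(2) by (intro exI[of _ "\<lambda>xs. LEAST y. f' (y # xs) = 0"]) simp
qed

lemma computes_least1:
  assumes "computes 2 (\<lambda>xs. f (xs ! 0) (xs ! 1))" "\<And>x. \<exists>y. f y x = 0"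
  shows "computes 1 (\<lambda>xs. LEAST y. f y (xs ! 0) = 0)"
  using computes_least_aux[of 1 "\<lambda>xs. f (xs ! 0) (xs ! 1)"] assms by (simp add: numeral_2_eq_2)

lemma computes_least2:
  assumes "computes 3 (\<lambda>xs. f (xs ! 0) (xs ! 1) (xs ! 2))" "\<And>x z. \<exists>y. f y x z = 0"
  shows "computes 2 (\<lambda>xs. LEAST y. f y (xs ! 0) (xs ! 1) = 0)"
  using computes_least_aux[of 2 "\<lambda>xs. f (xs ! 0) (xs ! 1) (xs ! 2)"] assms
  by (simp add: numeral_2_eq_2 numeral_3_eq_3)

named_theorems computes_intros

section \<open>Arithmetic and pairing\<close>

lemmas [computes_intros] = computes_const computes_Suc computes_proj

lemma computes_add [computes_intros]:
  "computes n a \<Longrightarrow> computes n b \<Longrightarrow> computes n (\<lambda>xs. a xs + b xs)"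
proof (rule computes_comp2[of "\<lambda>x y. x + y"])
  have "computes 2 (\<lambda>xs. rec_nat (xs ! 1) (\<lambda>k r. Suc r) (xs ! 0))"
    by (rule computes_rec2[of "\<lambda>x. x" "\<lambda>k r x. Suc r"]; intro computes_intros) simp_all
  moreover have "rec_nat x (\<lambda>k r. Suc r) y = y + x" for x y :: nat
    by (induction y) auto
  ultimately show "computes 2 (\<lambda>xs. xs ! 0 + xs ! 1)"
    by simp
qed

lemma computes_mult [computes_intros]:
  "computes n a \<Longrightarrow> computes n b \<Longrightarrow> computes n (\<lambda>xs. a xs * b xs)"
proof (rule computes_comp2[of "\<lambda>x y. x * y"])
  have "computes 2 (\<lambda>xs. rec_nat 0 (\<lambda>k r. r + xs ! 1) (xs ! 0))"
    by (rule computes_rec2[of "\<lambda>_. 0" "\<lambda>k r x. r + x"]; intro computes_intros) simp_all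
  moreover have "rec_nat 0 (\<lambda>k r. r + x) y = y * x" for x y :: nat
    by (induction y) auto
  ultimately show "computes 2 (\<lambda>xs. xs ! 0 * xs ! 1)"
    by simp
qed

lemma computes_pred: "computes n a \<Longrightarrow> computes n (\<lambda>xs. a xs - 1)"
proof (rule computes_comp1[of "\<lambda>x. x - 1"])
  have "computes 1 (\<lambda>xs. rec_nat 0 (\<lambda>k r. k) (xs ! 0))"
    by (rule computes_rec1; intro computes_intros) simp_all
  moreover have "rec_nat 0 (\<lambda>k r. k) x = x - 1" for x :: nat
    by (cases x) auto
  ultimately show "computes 1 (\<lambda>xs. xs ! 0 - 1)"
    by simp
qed

lemma computes_diff [computes_intros]:
  "computes n a \<Longrightarrow> computes n b \<Longrightarrow> computes n (\<lambda>xs. a xs - b xs)"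
proof (rule computes_comp2[of "\<lambda>x y. x - y"])
  have "computes 2 (\<lambda>xs. rec_nat (xs ! 1) (\<lambda>k r. r - 1) (xs ! 0))"
    by (rule computes_rec2[of "\<lambda>x. x" "\<lambda>k r x. r - 1"]; intro computes_pred computes_intros) simp_all
  moreover have "rec_nat x (\<lambda>k r. r - 1) y = x - y" for x y :: nat
    by (induction y) auto
  ultimately have "computes 2 (\<lambda>xs. xs ! 1 - xs ! 0)"
    by simp
  then show "computes 2 (\<lambda>xs. xs ! 0 - xs ! 1)"
    by (rule computes_comp2[of "\<lambda>x y. y - x"]; intro computes_intros) simp_all
qed

lemma computes_if [computes_intros]:
  assumes "computes n c" "computes n d" "computes n a" "computes n b"
  shows "computes n (\<lambda>xs. if c xs = d xs then a xs else b xs)"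
proof -
  have "computes 3 (\<lambda>xs. rec_nat (xs ! 1) (\<lambda>k r. xs ! 2) (xs ! 0))"
    by (rule computes_rec3[of "\<lambda>x y. x" "\<lambda>k r x y. y"]; intro computes_intros) simp_all
  moreover have "rec_nat x (\<lambda>k r. y) z = (if z = 0 then x else y)" for x y z :: nat
    by (cases z) auto
  ultimately have "computes 3 (\<lambda>xs. if xs ! 0 = 0 then xs ! 1 else xs ! 2)"
    by (simp only:)
  \<comment> \<open>With truncated subtraction, this sum is 0 exactly when
    \<open>c xs = d xs\<close>.\<close>
  then have "computes n (\<lambda>xs. if (c xs - d xs) + (d xs - c xs) = 0 then a xs else b xs)"
    by (rule computes_comp3[of "\<lambda>z x y. if z = 0 then x else y"]) (intro computes_intros assms)+
  then show ?thesis
    by (rule computes_cong) auto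
qed

text \<open>For truncated subtraction, \<open>Suc x - z = 0\<close> means \<open>x < z\<close>. The
  divisor \<open>Suc y\<close> is positive, so a solution always exists, as minimization
  requires.\<close>

lemma div_eq_Least: "x div Suc y = (LEAST q. Suc x - Suc q * Suc y = 0)"
proof (rule Least_equality[symmetric])
  show "Suc x - Suc (x div Suc y) * Suc y = 0"
    using dividend_less_div_times[of "Suc y" x] by simp
  show "x div Suc y \<le> q" if "Suc x - Suc q * Suc y = 0" for q
  proof -
    have "x < Suc q * Suc y"
      using that by linarith
    then have "x div Suc y < Suc q"
      by (intro less_mult_imp_div_less)
    then show ?thesis by simp
  qed
qed

lemma computes_div [computes_intros]:
  "computes n a \<Longrightarrow> computes n b \<Longrightarrow> computes n (\<lambda>xs. a xs div b xs)"
proof (rule computes_comp2[of "\<lambda>x y. x div y"])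
  have "computes 2 (\<lambda>xs. LEAST q. Suc (xs ! 0) - Suc q * Suc (xs ! 1) = 0)"
  proof (rule computes_least2[of "\<lambda>q x y. Suc x - Suc q * Suc y"])
    show "computes 3 (\<lambda>xs. Suc (xs ! 1) - Suc (xs ! 0) * Suc (xs ! 2))"
      by (intro computes_intros) simp_all
    show "\<exists>q. Suc x - Suc q * Suc y = 0" for x y
      by (intro exI[of _ x]) simp
  qed
  then have "computes 2 (\<lambda>xs. xs ! 0 div Suc (xs ! 1))"
    by (simp only: div_eq_Least)
  then have "computes 2 (\<lambda>xs. xs ! 0 div Suc (xs ! 1 - 1))"
    by (rule computes_comp2[of "\<lambda>x y. x div Suc y"]; intro computes_intros) simp_all
  \<comment> \<open>Division by 0, with value 0, is treated separately.\<close>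
  then have "computes 2 (\<lambda>xs. if xs ! 1 = 0 then 0 else xs ! 0 div Suc (xs ! 1 - 1))"
    by (intro computes_if computes_const computes_proj) simp_all
  then show "computes 2 (\<lambda>xs. xs ! 0 div xs ! 1)"
    by (rule computes_cong) auto
qed

lemma computes_mod [computes_intros]:
  assumes "computes n a" "computes n b"
  shows "computes n (\<lambda>xs. a xs mod b xs)"
  unfolding modulo_nat_def using assms by (intro computes_intros)

lemma computes_triangle [computes_intros]: "computes n a \<Longrightarrow> computes n (\<lambda>xs. triangle (a xs))"
  unfolding triangle_def by (intro computes_intros)

lemma computes_prod_encode [computes_intros]:
  "computes n a \<Longrightarrow> computes n b \<Longrightarrow> computes n (\<lambda>xs. prod_encode (a xs, b xs))"
  unfolding prod_encode_def prod.case by (intro computes_intros)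

lemma le_triangle: "n \<le> triangle n"
  by (induction n) auto

lemma triangle_mono: "m \<le> n \<Longrightarrow> triangle m \<le> triangle n"
  unfolding triangle_def by (intro div_le_mono mult_le_mono) auto

text \<open>A code of \<open>(a, b)\<close> is \<open>triangle (a + b) + a\<close>, so the diagonal
  \<open>a + b\<close> is the least \<open>s\<close> with \<open>z < triangle (Suc s)\<close>; this
  makes decoding an instance of minimization.\<close>

lemma prod_decode_Least:
  defines "s \<equiv> \<lambda>z. LEAST s. Suc z - triangle (Suc s) = 0"
  shows "fst (prod_decode z) = z - triangle (s z)"
    and "snd (prod_decode z) = s z - (z - triangle (s z))"
proof -
  obtain a b where ab: "prod_decode z = (a, b)"
    by (cases "prod_decode z")
  then have z: "z = triangle (a + b) + a"
    using prod_decode_inverse[of z] by (simp add: ab prod_encode_def)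
  have "s z = a + b"
    unfolding s_def
  proof (rule Least_equality)
    show "Suc z - triangle (Suc (a + b)) = 0"
      by (simp add: z)
    show "a + b \<le> t" if "Suc z - triangle (Suc t) = 0" for t
    proof (rule ccontr)
      assume "\<not> a + b \<le> t"
      then have "triangle (Suc t) \<le> triangle (a + b)"
        by (intro triangle_mono) simp
      moreover have "Suc z \<le> triangle (Suc t)"
        using that by linarith
      ultimately show False
        using z by linarith
    qed
  qed
  moreover have "z - triangle (a + b) = a"
    using z by linarith
  ultimately show "fst (prod_decode z) = z - triangle (s z)"
    and "snd (prod_decode z) = s z - (z - triangle (s z))"
    by (simp_all add: ab)
qed

lemma computes_decode_sum: "computes n a \<Longrightarrow> computes n (\<lambda>xs. LEAST s. Suc (a xs) - triangle (Suc s) = 0)"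
proof (rule computes_comp1[of "\<lambda>z. LEAST s. Suc z - triangle (Suc s) = 0"], rule computes_least1)
  show "computes 2 (\<lambda>xs. Suc (xs ! 1) - triangle (Suc (xs ! 0)))"
    by (intro computes_intros) simp_all
  show "\<exists>s. Suc z - triangle (Suc s) = 0" for z
    using le_triangle[of "Suc z"] by (intro exI[of _ z]) (simp del: triangle_Suc)
qed

lemma computes_fst_decode [computes_intros]:
  "computes n a \<Longrightarrow> computes n (\<lambda>xs. fst (prod_decode (a xs)))"
  unfolding prod_decode_Least by (intro computes_intros computes_decode_sum)

lemma computes_snd_decode [computes_intros]:
  "computes n a \<Longrightarrow> computes n (\<lambda>xs. snd (prod_decode (a xs)))"
  unfolding prod_decode_Least by (intro computes_intros computes_decode_sum)

section \<open>Operations on codes of words\<close>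

definition hd_code :: "nat \<Rightarrow> nat" where
  "hd_code c = fst (prod_decode (c - 1))"

definition tl_code :: "nat \<Rightarrow> nat" where
  "tl_code c = snd (prod_decode (c - 1))"

definition drop_code :: "nat \<Rightarrow> nat \<Rightarrow> nat" where
  "drop_code n c = rec_nat c (\<lambda>k r. tl_code r) n"

definition letter_code :: "nat \<times> bool \<Rightarrow> nat" where
  "letter_code = (\<lambda>(i, b). 2 * i + of_bool b)"

text \<open>The sign of a letter is the parity of its code.\<close>

definition flip_code :: "nat \<Rightarrow> nat" where
  "flip_code l = (if l mod 2 = 0 then Suc l else l - 1)"

definition push_code :: "nat \<Rightarrow> nat \<Rightarrow> nat" where
  "push_code l s = (if s = 0 then Suc (prod_encode (l, 0))
     else if hd_code s = flip_code l then tl_code s else Suc (prod_encode (l, s)))"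

text \<open>\<open>n\<close> bounds the number of letters read; steps beyond the end of the word
  leave the stack unchanged. As a code is at least the length of its word, it can itself serve as
  the bound.\<close>

definition fold_push_code :: "nat \<Rightarrow> nat \<Rightarrow> nat \<Rightarrow> nat" where
  "fold_push_code n s c = rec_nat s
     (\<lambda>k r. if drop_code k c = 0 then r else push_code (hd_code (drop_code k c)) r) n"

definition reduce_code :: "nat \<Rightarrow> nat" where
  "reduce_code c = fold_push_code c 0 c"

definition cut_code :: "nat \<Rightarrow> nat \<Rightarrow> nat \<Rightarrow> nat \<Rightarrow> nat" where
  "cut_code s i j c = fold_push_code c (fold_push_code i s c) (drop_code j c)"

text \<open>After \<open>k\<close> rounds the stack holds the reduced form of the
  \<open>k\<close>-th power of \<open>take i p @ drop j p\<close>, read backwards, where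
  \<open>c\<close> codes \<open>p\<close>.\<close>

definition cut_pow_code :: "nat \<Rightarrow> nat \<Rightarrow> nat \<Rightarrow> nat \<Rightarrow> nat" where
  "cut_pow_code k i j c = rec_nat 0 (\<lambda>_ r. cut_code r i j c) k"

lemma computes_hd_code [computes_intros]: "computes n a \<Longrightarrow> computes n (\<lambda>xs. hd_code (a xs))"
  unfolding hd_code_def by (intro computes_intros)

lemma computes_tl_code [computes_intros]: "computes n a \<Longrightarrow> computes n (\<lambda>xs. tl_code (a xs))"
  unfolding tl_code_def by (intro computes_intros)

lemma computes_drop_code [computes_intros]:
  "computes n a \<Longrightarrow> computes n b \<Longrightarrow> computes n (\<lambda>xs. drop_code (a xs) (b xs))"
  by (rule computes_comp2[of drop_code], unfold drop_code_def,
      rule computes_rec2[of "\<lambda>x. x" "\<lambda>k r x. tl_code r"]) (intro computes_intros; simp)+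

lemma computes_flip_code [computes_intros]: "computes n a \<Longrightarrow> computes n (\<lambda>xs. flip_code (a xs))"
  unfolding flip_code_def by (intro computes_intros)

lemma computes_push_code [computes_intros]:
  "computes n a \<Longrightarrow> computes n b \<Longrightarrow> computes n (\<lambda>xs. push_code (a xs) (b xs))"
  unfolding push_code_def by (intro computes_intros)

lemma computes_fold_push_code [computes_intros]:
  "computes n a \<Longrightarrow> computes n b \<Longrightarrow> computes n c \<Longrightarrow>
    computes n (\<lambda>xs. fold_push_code (a xs) (b xs) (c xs))"
  by (rule computes_comp3[of fold_push_code], unfold fold_push_code_def,
      rule computes_rec3[of "\<lambda>x y. x" "\<lambda>k r x c. if drop_code k c = 0 then r else push_code (hd_code (drop_code k c)) r"])
    (intro computes_intros; simp)+

lemma computes_reduce_code [computes_intros]: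
  "computes n a \<Longrightarrow> computes n (\<lambda>xs. reduce_code (a xs))"
  unfolding reduce_code_def by (intro computes_intros)

lemma computes_cut_code [computes_intros]:
  "computes n a \<Longrightarrow> computes n b \<Longrightarrow> computes n c \<Longrightarrow> computes n d \<Longrightarrow>
    computes n (\<lambda>xs. cut_code (a xs) (b xs) (c xs) (d xs))"
  unfolding cut_code_def by (intro computes_intros)

lemma computes_cut_pow_code [computes_intros]:
  "computes n a \<Longrightarrow> computes n b \<Longrightarrow> computes n c \<Longrightarrow> computes n d \<Longrightarrow>
    computes n (\<lambda>xs. cut_pow_code (a xs) (b xs) (c xs) (d xs))"
  by (rule computes_comp4[of cut_pow_code], unfold cut_pow_code_def,
      rule computes_rec4[of "\<lambda>x y z. 0" "\<lambda>k r x y z. cut_code r x y z"])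
    (intro computes_intros; simp)+

section \<open>Correctness of the operations on codes\<close>

lemma word_code_simps [simp]:
  "word_code [] = 0" "word_code (l # p) = Suc (prod_encode (letter_code l, word_code p))"
  by (simp_all add: word_code_def letter_code_def)

lemma word_code_eq_0 [simp]: "word_code p = 0 \<longleftrightarrow> p = []"
  by (cases p) auto

lemma letter_code_inj: "letter_code l = letter_code m \<longleftrightarrow> l = m"
  unfolding letter_code_def by (cases l; cases m) (auto simp: of_bool_def split: if_splits, presburger+)

lemma word_code_inj: "word_code p = word_code q \<longleftrightarrow> p = q"
proof (induction p arbitrary: q)
  case Nil
  show ?case by (cases q) auto
next
  case (Cons l p)
  then show ?case by (cases q) (auto simp: letter_code_inj)
qed

lemma length_le_word_code: "length p \<le> word_code p"
  by (induction p) (auto intro: le_trans[OF _ le_prod_encode_2])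

lemma hd_code [simp]: "hd_code (Suc (prod_encode (a, b))) = a"
  by (simp add: hd_code_def)

lemma tl_code [simp]: "tl_code (Suc (prod_encode (a, b))) = b"
  by (simp add: tl_code_def)

lemma tl_code_word_code [simp]: "tl_code (word_code p) = word_code (tl p)"
proof (cases p)
  case Nil
  have "prod_decode 0 = (0, 0)"
    using prod_encode_inverse[of "(0, 0)"] by (simp add: prod_encode_def)
  then show ?thesis
    using Nil by (simp add: tl_code_def)
qed (simp add: tl_code_def)

lemma drop_code_word_code [simp]: "drop_code n (word_code p) = word_code (drop n p)"
  by (induction n) (simp_all add: drop_code_def drop_Suc tl_drop)

lemma flip_code_letter_code [simp]: "flip_code (letter_code l) = letter_code (flip l)"
  by (cases l) (auto simp: flip_code_def letter_code_def flip_def)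

lemma push_code_word_code [simp]: "push_code (letter_code l) (word_code s) = word_code (push l s)"
proof (cases s)
  case (Cons m s')
  then show ?thesis
    by (simp add: push_code_def letter_code_inj)
qed (simp add: push_code_def)

lemma fold_push_code_word_code [simp]:
  "fold_push_code n (word_code s) (word_code p) = word_code (fold push (take n p) s)"
proof (induction n)
  case (Suc n)
  show ?case
  proof (cases "n < length p")
    case True
    then have "drop n p = p ! n # drop (Suc n) p" "take (Suc n) p = take n p @ [p ! n]"
      by (simp_all add: Cons_nth_drop_Suc take_Suc_conv_app_nth)
    then show ?thesis
      using Suc True by (simp add: fold_push_code_def)
  next
    case False
    then show ?thesis
      using Suc by (simp add: fold_push_code_def)
  qed
qed (simp add: fold_push_code_def)

lemma reduce_code_word_code [simp]: "reduce_code (word_code p) = word_code (reduce_rev p)"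
  using fold_push_code_word_code[of "word_code p" "[]" p] length_le_word_code[of p]
  by (simp add: reduce_code_def reduce_rev_def del: fold_push_code_word_code)

lemma cut_code_word_code [simp]:
  "cut_code (word_code s) i j (word_code p) = word_code (fold push (take i p @ drop j p) s)"
  using length_le_word_code[of p] by (simp add: cut_code_def)

lemma cut_pow_code_word_code [simp]:
  "cut_pow_code k i j (word_code p) = word_code ((fold push (take i p @ drop j p) ^^ k) [])"
proof (induction k)
  case (Suc k)
  then show ?case
    unfolding cut_pow_code_def by (simp add: cut_code_word_code[unfolded fold_append comp_def] comp_def)
qed (simp add: cut_pow_code_def)

section \<open>Computing the closure\<close>

text \<open>Minimization demands a solution for every number \<open>c\<close>; hence each
  \<open>c\<close> has to be read as the code of a word.\<close>

lemma word_code_surj: "\<exists>p. word_code p = c"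
proof (induction c rule: less_induct)
  case (less c)
  show ?case
  proof (cases c)
    case 0
    then show ?thesis
      by (intro exI[of _ "[]"]) simp
  next
    case (Suc n)
    obtain a b where ab: "prod_decode n = (a, b)"
      by (cases "prod_decode n")
    then have n: "n = prod_encode (a, b)"
      by (metis prod_decode_inverse)
    then have "b < c"
      using le_prod_encode_2[of b a] Suc by simp
    then obtain p where "word_code p = b"
      using less by blast
    moreover have "letter_code (a div 2, odd a) = a"
      by (simp add: letter_code_def)
    ultimately show ?thesis
      using Suc n by (intro exI[of _ "(a div 2, odd a) # p"]) simp
  qed
qed

text \<open>A sum that encodes a bounded universal quantifier over divisors. For
  \<open>d = 0\<close> the condition says \<open>k = 0\<close>, since
  \<open>k mod 0 = k\<close>.\<close>

definition divisor_sum :: "(nat \<Rightarrow> nat) \<Rightarrow> nat \<Rightarrow> nat" where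
  "divisor_sum f k = rec_nat 0 (\<lambda>d r. r + (if k mod d = 0 then f d else 0)) (Suc k)"

lemma divisor_sum_eq_0: "divisor_sum f k = 0 \<longleftrightarrow> (\<forall>d\<le>k. d dvd k \<longrightarrow> f d = 0)"
proof -
  have "rec_nat 0 (\<lambda>d r. r + (if k mod d = 0 then f d else 0)) n = 0 \<longleftrightarrow>
      (\<forall>d<n. d dvd k \<longrightarrow> f d = 0)" for n
    by (induction n) (auto simp: less_Suc_eq dvd_eq_mod_eq_0)
  then show ?thesis
    by (simp only: divisor_sum_def less_Suc_eq_le)
qed

lemma computes_divisor_sum:
  assumes "computes 1 (\<lambda>xs. f (xs ! 0))" "computes n a"
  shows "computes n (\<lambda>xs. divisor_sum f (a xs))"
proof (rule computes_comp1[of "divisor_sum f", OF _ assms(2)])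
  have f: "computes 3 (\<lambda>xs. f (xs ! 0))"
    by (rule computes_comp1[of f, OF assms(1)]) (intro computes_intros; simp)
  have "computes 2 (\<lambda>xs. rec_nat 0 (\<lambda>d r. r + (if xs ! 1 mod d = 0 then f d else 0)) (xs ! 0))"
    by (rule computes_rec2[of "\<lambda>x. 0" "\<lambda>d r x. r + (if x mod d = 0 then f d else 0)"];
        intro computes_intros f) simp_all
  then show "computes 1 (\<lambda>xs. divisor_sum f (xs ! 0))"
    unfolding divisor_sum_def
    by (rule computes_comp2[of "\<lambda>y x. rec_nat 0 (\<lambda>d r. r + (if x mod d = 0 then f d else 0)) y"];
        intro computes_intros) simp_all
qed

text \<open>
  A candidate \<open>(k, i, j)\<close> with \<open>k, i, j \<le> c\<close> is coded by the digits \<open>c - k, i, j\<close> of \<open>y\<close> in base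
  \<open>c + 1\<close>. Hence the least \<open>y\<close> passing a test belongs to the largest \<open>k\<close>.
\<close>

definition digit_k :: "nat \<Rightarrow> nat \<Rightarrow> nat" where
  "digit_k y c = c - y div (Suc c * Suc c)"

definition digit_i :: "nat \<Rightarrow> nat \<Rightarrow> nat" where
  "digit_i y c = y div Suc c mod Suc c"

definition digit_j :: "nat \<Rightarrow> nat \<Rightarrow> nat" where
  "digit_j y c = y mod Suc c"

definition root_test :: "(nat \<Rightarrow> nat) \<Rightarrow> nat \<Rightarrow> nat \<Rightarrow> nat" where
  "root_test f y c =
    (if cut_pow_code (digit_k y c) (digit_i y c) (digit_j y c) c = reduce_code c
     then divisor_sum f (digit_k y c) else 1)"

definition root_search :: "(nat \<Rightarrow> nat) \<Rightarrow> nat \<Rightarrow> nat" where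
  "root_search f c = (LEAST y. root_test f y c = 0)"

lemma digits:
  assumes "k \<le> c" "i \<le> c" "j \<le> c"
  defines "y \<equiv> ((c - k) * Suc c + i) * Suc c + j"
  shows "digit_k y c = k" "digit_i y c = i" "digit_j y c = j"
proof -
  have j: "y mod Suc c = j" "y div Suc c = (c - k) * Suc c + i"
    using assms(3) by (simp_all add: y_def div_mult_self3 del: mult_Suc_right mult_Suc)
  have i: "((c - k) * Suc c + i) mod Suc c = i" "((c - k) * Suc c + i) div Suc c = c - k"
    using assms(2) by (simp_all del: mult_Suc_right mult_Suc)
  show "digit_k y c = k"
    using assms(1) unfolding digit_k_def div_mult2_eq j i by simp
  show "digit_i y c = i" "digit_j y c = j"
    unfolding digit_i_def digit_j_def j i by simp_all
qed

lemma computes_root_test: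
  assumes "computes 1 (\<lambda>xs. f (xs ! 0))" "computes n a" "computes n b"
  shows "computes n (\<lambda>xs. root_test f (a xs) (b xs))"
  unfolding root_test_def digit_k_def digit_i_def digit_j_def
  by (intro computes_intros computes_divisor_sum[of f] assms)

text \<open>A nonempty word passes with \<open>k = 1\<close> and \<open>i = j = c\<close>: these
  positions are not before its end, so the cut leaves it unchanged. The empty word has code 0 and
  passes with \<open>k = 0\<close>.\<close>

lemma root_test_solvable:
  assumes "f 0 = 0" "f 1 = 0"
  shows "\<exists>y. root_test f y c = 0"
proof -
  obtain p where p: "c = word_code p"
    using word_code_surj by metis
  define k where "k = (if p = [] then 0 else 1 :: nat)"
  have "k \<le> c"
    by (cases p) (auto simp: k_def p)
  note d = digits[OF this order_refl order_refl]
  have "divisor_sum f k = 0"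
    using assms by (auto simp: divisor_sum_eq_0 k_def le_Suc_eq)
  moreover have "cut_pow_code k c c c = reduce_code c"
    using length_le_word_code[of p] by (auto simp: p k_def reduce_rev_def)
  ultimately show ?thesis
    using d by (intro exI[of _ "((c - k) * Suc c + c) * Suc c + c"]) (simp add: root_test_def)
qed

lemma computes_root_search:
  assumes f: "computes 1 (\<lambda>xs. f (xs ! 0))" "f 0 = 0" "f 1 = 0" and a: "computes n a"
  shows "computes n (\<lambda>xs. root_search f (a xs))"
proof (rule computes_comp1[of "root_search f", OF _ a])
  show "computes 1 (\<lambda>xs. root_search f (xs ! 0))"
    unfolding root_search_def
  proof (rule computes_least1)
    show "computes 2 (\<lambda>xs. root_test f (xs ! 0) (xs ! 1))"
      by (intro computes_root_test f(1) computes_intros) simp_all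
  qed (rule root_test_solvable[OF f(2,3)])
qed

definition cut :: "nat \<Rightarrow> nat \<Rightarrow> 'b list \<Rightarrow> 'b list" where
  "cut i j p = take i p @ drop j p"

text \<open>A candidate that passes has a number \<open>z \<ge> y\<close>, so its leading digit
  \<open>c - k\<close> is at least that of \<open>y\<close>. The bound
  \<open>length p \<le> c\<close> puts all the cuts of \<open>p\<close> among the
  candidates.\<close>

lemma root_search_maximal:
  fixes p :: "(nat \<times> bool) list"
  assumes f: "f 0 = 0" "f 1 = 0"
  defines "c \<equiv> word_code p"
  defines "y \<equiv> root_search f c"
  shows "(fold push (cut (digit_i y c) (digit_j y c) p) ^^ digit_k y c) [] = reduce_rev p"
    "\<forall>d\<le>digit_k y c. d dvd digit_k y c \<longrightarrow> f d = 0"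
    "\<And>k i j. k \<le> length p \<Longrightarrow> i \<le> length p \<Longrightarrow> j \<le> length p \<Longrightarrow>
      (fold push (cut i j p) ^^ k) [] = reduce_rev p \<Longrightarrow> \<forall>d\<le>k. d dvd k \<longrightarrow> f d = 0 \<Longrightarrow>
      k \<le> digit_k y c"
proof -
  have test: "root_test f z c = 0 \<longleftrightarrow>
      (fold push (cut (digit_i z c) (digit_j z c) p) ^^ digit_k z c) [] = reduce_rev p \<and>
      (\<forall>d\<le>digit_k z c. d dvd digit_k z c \<longrightarrow> f d = 0)" for z
    unfolding root_test_def cut_def
    using cut_pow_code_word_code[of "digit_k z c" "digit_i z c" "digit_j z c" p]
    by (simp add: c_def word_code_inj divisor_sum_eq_0 del: fold_append cut_pow_code_word_code)
  have "root_test f y c = 0"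
    unfolding y_def root_search_def using root_test_solvable[OF f] by (rule LeastI_ex)
  then show "(fold push (cut (digit_i y c) (digit_j y c) p) ^^ digit_k y c) [] = reduce_rev p"
    "\<forall>d\<le>digit_k y c. d dvd digit_k y c \<longrightarrow> f d = 0"
    using test by blast+
  show "k \<le> digit_k y c" if "k \<le> length p" "i \<le> length p" "j \<le> length p"
    "(fold push (cut i j p) ^^ k) [] = reduce_rev p" "\<forall>d\<le>k. d dvd k \<longrightarrow> f d = 0" for k i j
  proof -
    have le: "k \<le> c" "i \<le> c" "j \<le> c"
      using that(1-3) length_le_word_code[of p] by (auto simp: c_def)
    define z where "z = ((c - k) * Suc c + i) * Suc c + j"
    note z = digits[OF le, folded z_def]
    have "root_test f z c = 0"
      unfolding test z using that(4,5) by blast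
    then have "y \<le> z"
      unfolding y_def root_search_def by (rule Least_le)
    then have "y div (Suc c * Suc c) \<le> z div (Suc c * Suc c)"
      by (rule div_le_mono)
    then have "digit_k z c \<le> digit_k y c"
      unfolding digit_k_def by (rule diff_le_mono2)
    then show ?thesis
      by (simp add: z)
  qed
qed

definition normal_form :: "('i \<times> bool) list \<Rightarrow> ('i \<times> bool) list" where
  "normal_form p = rev (reduce_rev p)"

text \<open>The input is reduced first because the segment that gives \<open>u [^] m\<close> is
  located in the reduced word of \<open>w\<close>.\<close>

definition closure_word :: "(nat \<Rightarrow> nat) \<Rightarrow> (nat \<times> bool) list \<Rightarrow> (nat \<times> bool) list" where
  "closure_word f p = (let p' = normal_form p; c = word_code p'; y = root_search f c
     in normal_form (cut (digit_i y c) (digit_j y c) p'))"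

lemma reduced_normal_form: "reduced (normal_form p)"
  by (simp add: normal_form_def reduce_rev_def fold_push_reduced)

text \<open>One reduction leaves the reduced word reversed; a second one has nothing to cancel and
  restores the order.\<close>

lemma reduce_code_twice: "reduce_code (reduce_code (word_code p)) = word_code (normal_form p)"
  using reduced_normal_form[of p] by (simp add: normal_form_def reduce_rev_reduced)

lemma normal_form_words_over: "p \<in> words_over I \<Longrightarrow> normal_form p \<in> words_over I"
  by (simp add: normal_form_def reduce_rev_def fold_push_words_over)

lemma computable_closure_word:
  assumes f: "computes 1 (\<lambda>xs. f (xs ! 0))" "f 0 = 0" "f 1 = 0"
  shows "computable_on_words (closure_word f)"
proof -
  define out where "out c y = reduce_code (cut_code 0 (digit_i y c) (digit_j y c) c)" for c y
  have out: "computes n (\<lambda>xs. out (a xs) (b xs))" if "computes n a" "computes n b" for n a b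
    unfolding out_def digit_i_def digit_j_def by (intro computes_intros that)
  have "computes 1 (\<lambda>xs. out (reduce_code (reduce_code (xs ! 0)))
      (root_search f (reduce_code (reduce_code (xs ! 0)))))"
    by (intro out computes_root_search f computes_intros) simp_all
  then obtain h where h: "recursive_fun 1 h" "\<And>xs. length xs = 1 \<Longrightarrow>
      h xs = out (reduce_code (reduce_code (xs ! 0))) (root_search f (reduce_code (reduce_code (xs ! 0))))"
    unfolding computes_def by metis
  have "h [word_code p] = word_code (closure_word f p)" for p
  proof -
    define p' where "p' = normal_form p"
    define c where "c = word_code p'"
    define y where "y = root_search f c"
    have "h [word_code p] = out c y"
      by (simp add: h(2) reduce_code_twice c_def p'_def y_def del: reduce_code_word_code)
    also have "cut_code 0 (digit_i y c) (digit_j y c) c = reduce_code (word_code (cut (digit_i y c) (digit_j y c) p'))"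
      using cut_code_word_code[of "[]" "digit_i y c" "digit_j y c" p']
      by (simp add: c_def cut_def reduce_rev_def)
    then have "out c y = word_code (normal_form (cut (digit_i y c) (digit_j y c) p'))"
      by (simp only: out_def reduce_code_twice)
    also have "\<dots> = word_code (closure_word f p)"
      by (simp add: closure_word_def Let_def c_def p'_def y_def)
    finally show ?thesis .
  qed
  then show ?thesis
    unfolding computable_on_words_def using h(1) by blast
qed

lemma (in group) word_eval_fold_push_funpow:
  assumes "x \<in> I \<rightarrow> carrier G" "q \<in> words_over I"
  shows "(fold push q ^^ k) [] \<in> words_over I \<and> reduced ((fold push q ^^ k) []) \<and>
    word_eval G x (rev ((fold push q ^^ k) [])) = word_eval G x q [^] k"
proof (induction k)
  case (Suc k)
  then show ?case
    using assms
    by (simp add: fold_push_words_over fold_push_reduced word_eval_fold_push[OF assms(1)])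
qed simp

context free_group_pseudovariety
begin

lemma free_group_root:
  assumes "W \<in> words_over X" "reduced W" "W \<noteq> []"
  shows "free_group_root F X V (grp_root F (eval W)) (eval W) (grp_exp F (eval W))"
proof -
  note root = root_exp_reduced_word[OF assms]
  show ?thesis
    using root(1-5) by unfold_locales auto
qed

text \<open>The cut with value \<open>u [^] m\<close> and exponent \<open>e div m\<close> is a
  candidate that passes, so the search returns an exponent at least this large, and
  \<open>maximal_root\<close> identifies the value of the word found.\<close>

lemma closure_word_correct:
  fixes x :: "nat \<Rightarrow> 'a"
  assumes f: "\<And>n. f n = (if 2 \<le> n \<and> in_class (integer_mod_group n) V then 1 else 0)"
    and x: "inj_on x I" "x ` I \<subseteq> X" and p: "p \<in> words_over I" "word_eval F x p \<noteq> \<one>"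
  shows "closure_word f p \<in> words_over I"
    "pro_topology V F closure_of generate F {word_eval F x p} =
      generate F {word_eval F x (closure_word f p)}"
proof -
  define p' where "p' = normal_form p"
  define c where "c = word_code p'"
  define y where "y = root_search f c"
  define i j k where "i = digit_i y c" and "j = digit_j y c" and "k = digit_k y c"
  define q where "q = cut i j p'"
  have cw: "closure_word f p = normal_form q"
    by (simp add: closure_word_def Let_def q_def i_def j_def y_def c_def p'_def)
  have f01: "f 0 = 0" "f 1 = 0"
    by (simp_all add: f)
  note search = root_search_maximal[OF f01, where p = p', folded c_def, folded y_def, folded i_def j_def k_def, folded q_def]
  have p': "p' \<in> words_over I" "reduced p'"
    using p(1) by (simp_all add: p'_def normal_form_words_over reduced_normal_form)
  have cut_over: "cut i j p' \<in> words_over I" for i j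
    using p'(1) by (simp add: cut_def words_over_take_drop)
  then have q: "q \<in> words_over I"
    by (simp add: q_def)
  then show "closure_word f p \<in> words_over I"
    by (simp add: cw normal_form_words_over)
  have xI: "x \<in> I \<rightarrow> carrier F"
    using x(2) basis by auto
  have nf_eval: "word_eval F x (normal_form r) = word_eval F x r" if "r \<in> words_over I" for r
    using word_eval_reduce_rev[OF xI that] by (simp add: normal_form_def)
  \<comment> \<open>This replaces numerical names by basis elements. Injectivity of \<open>x\<close>
    on \<open>I\<close> keeps reduced words reduced and distinct, so uniqueness of reduced words
    carries over to words over \<open>I\<close>.\<close>
  define \<iota> where "\<iota> = map (map_prod x (id :: bool \<Rightarrow> bool))"
  have \<iota>_eval: "eval (\<iota> r) = word_eval F x r" for r
    unfolding \<iota>_def by (rule word_eval_map)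
  have \<iota>_over: "\<iota> r \<in> words_over X" if "r \<in> words_over I" for r
    using that x(2) by (induction r) (auto simp: \<iota>_def)
  have \<iota>_reduced: "reduced (\<iota> r)" if "r \<in> words_over I" "reduced r" for r
    using that
  proof (induction r)
    case (Cons l r)
    show ?case
    proof (cases r)
      case (Cons l' r')
      have "map_prod x id l' \<noteq> flip (map_prod x id l)"
      proof
        assume "map_prod x id l' = flip (map_prod x id l)"
        then have "x (fst l') = x (fst l)" "snd l' = (\<not> snd l)"
          by (simp_all add: flip_def prod_eq_iff)
        moreover have "fst l' \<in> I" "fst l \<in> I"
          using Cons.prems(1) Cons by simp_all
        ultimately have "l' = flip l"
          using inj_onD[OF x(1)] by (auto simp: flip_def prod_eq_iff)
        then show False
          using Cons.prems(2) Cons by (simp add: reduced_Cons)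
      qed
      then show ?thesis
        using Cons.IH Cons.prems Cons by (simp add: \<iota>_def reduced_Cons)
    qed (simp add: \<iota>_def reduced_Cons)
  qed (simp add: \<iota>_def)
  have \<iota>_inj: "r = s" if "\<iota> r = \<iota> s" "r \<in> words_over I" "s \<in> words_over I" for r s
  proof -
    have "inj_on (map_prod x (id :: bool \<Rightarrow> bool)) (I \<times> UNIV)"
      using x(1) by (auto simp: inj_on_def)
    then show ?thesis
      using that inj_on_mapI[of "map_prod x (id :: bool \<Rightarrow> bool)" "{r, s}"]
      unfolding \<iota>_def words_over_def by (intro map_inj_on[of "map_prod x id"]) (auto intro: inj_on_subset)
  qed
  have unique: "r = s" if "word_eval F x r = word_eval F x s" "r \<in> words_over I" "reduced r"
    "s \<in> words_over I" "reduced s" for r s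
    using that by (intro \<iota>_inj reduced_word_unique) (simp_all add: \<iota>_eval \<iota>_over \<iota>_reduced)
  define w where "w = word_eval F x p'"
  have wp: "word_eval F x p = w"
    using nf_eval[OF p(1)] by (simp add: w_def p'_def)
  then have "p' \<noteq> []"
    using p(2) by (auto simp: w_def)
  define W where "W = \<iota> p'"
  have W: "W \<in> words_over X" "reduced W" "W \<noteq> []"
    using p' \<open>p' \<noteq> []\<close> by (simp_all add: W_def \<iota>_over \<iota>_reduced) (simp add: \<iota>_def)
  have eval_W: "eval W = w"
    by (simp add: W_def \<iota>_eval w_def)
  have lenW: "length W = length p'"
    by (simp add: W_def \<iota>_def)
  define u e where "u = grp_root F w" and "e = grp_exp F w"
  note root = root_exp_reduced_word[OF W, unfolded eval_W, folded u_def e_def]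
  interpret free_group_root F X V u w e
    using free_group_root[OF W] by (simp add: eval_W u_def e_def)
  have reduce_p': "reduce_rev p' = rev p'"
    using p'(2) by (rule reduce_rev_reduced)
  \<comment> \<open>Both stacks hold reduced words, so comparing them amounts to comparing values in
    \<open>F\<close>.\<close>
  have power_iff: "(fold push r ^^ n) [] = reduce_rev p' \<longleftrightarrow> word_eval F x r [^] n = w"
    if "r \<in> words_over I" for r n
  proof -
    note fp = word_eval_fold_push_funpow[OF xI that, of n]
    have "(fold push r ^^ n) [] = reduce_rev p' \<longleftrightarrow> rev ((fold push r ^^ n) []) = p'"
      unfolding reduce_p' by auto
    also have "\<dots> \<longleftrightarrow> word_eval F x (rev ((fold push r ^^ n) [])) = w"
      using unique[of "rev ((fold push r ^^ n) [])" p'] fp p' by (auto simp: w_def)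
    finally show ?thesis
      using fp by simp
  qed
  define k0 where "k0 = e div m"
  have "k0 \<le> e"
    by (simp add: k0_def)
  have "m \<le> e"
    using m_dvd_e e_pos by (simp add: dvd_imp_le)
  then obtain i0 j0 where ij0: "i0 \<le> length W" "j0 \<le> length W" "eval (take i0 W @ drop j0 W) = u [^] m"
    using root(6) by blast
  have "take i0 W @ drop j0 W = \<iota> (cut i0 j0 p')"
    by (simp add: W_def \<iota>_def cut_def take_map drop_map)
  then have "word_eval F x (cut i0 j0 p') [^] k0 = w"
    using ij0(3) u m_dvd_e by (simp add: \<iota>_eval nat_pow_pow k0_def w)
  then have "(fold push (cut i0 j0 p') ^^ k0) [] = reduce_rev p'"
    using power_iff[OF cut_over] by blast
  moreover have "\<forall>d\<le>k0. d dvd k0 \<longrightarrow> f d = 0"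
    using cofactor_free by (auto simp: f k0_def)
  ultimately have "k0 \<le> k"
    using ij0(1,2) root(7) \<open>k0 \<le> e\<close> by (intro search(3)) (auto simp: lenW)
  have "word_eval F x q = u [^] m"
  proof (rule maximal_root[of _ k])
    show "word_eval F x q \<in> carrier F"
      using word_eval_closed[OF xI q] .
    show "word_eval F x q [^] k = w"
      using search(1) power_iff[OF q] by blast
    show "e div m \<le> k"
      using \<open>k0 \<le> k\<close> by (simp add: k0_def)
    show "\<not> in_class (integer_mod_group d) V" if "d dvd k" "2 \<le> d" for d
    proof -
      \<comment> \<open>The search controls only divisors \<open>d \<le> k\<close>, which are all
        divisors once \<open>k > 0\<close>. For \<open>k = 0\<close> the power would be empty,
        unlike \<open>p'\<close>.\<close>
      have "k > 0"
      proof (rule Nat.gr0I)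
        assume "k = 0"
        then have "(fold push q ^^ k) [] = []"
          by simp
        then show False
          using search(1) \<open>p' \<noteq> []\<close> by (simp add: reduce_p')
      qed
      then have "d \<le> k"
        using that by (simp add: dvd_imp_le)
      then have "f d = 0"
        using search(2) that by blast
      then show ?thesis
        using that f by (auto split: if_splits)
    qed
  qed
  then show "pro_topology V F closure_of generate F {word_eval F x p} =
      generate F {word_eval F x (closure_word f p)}"
    unfolding wp cw nf_eval[OF q] closure_cyclic by simp
qed

lemma closure_computable_if_decidable:
  assumes "decidable_set {n. 2 \<le> n \<and> in_class (integer_mod_group n) V}"
  shows "closure_computable V F X"
proof -
  \<comment> \<open>\<open>f\<close> marks the orders forbidden as divisors of the exponent; leaving
    0 and 1 unmarked keeps the search total.\<close>
  define f :: "nat \<Rightarrow> nat" where "f n = (if 2 \<le> n \<and> in_class (integer_mod_group n) V then 1 else 0)" for n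
  obtain h where h: "recursive_fun 1 h" "\<And>n. h [n] = f n"
    using assms unfolding decidable_set_def f_def by auto
  have "h xs = f (xs ! 0)" if "length xs = 1" for xs
    using that h(2) by (cases xs) auto
  then have "computes 1 (\<lambda>xs. f (xs ! 0))"
    unfolding computes_def using h(1) by blast
  then have "computable_on_words (closure_word f)"
    by (rule computable_closure_word) (simp_all add: f_def)
  show ?thesis
    unfolding closure_computable_def
  proof (intro exI[of _ "closure_word f"] conjI allI impI)
    show "computable_on_words (closure_word f)"
      by fact
    fix I and x :: "nat \<Rightarrow> 'a" and p
    assume "inj_on x I \<and> x ` I \<subseteq> X \<and> p \<in> words_over I \<and> word_eval F x p \<noteq> \<one>"
    then have *: "inj_on x I" "x ` I \<subseteq> X" "p \<in> words_over I" "word_eval F x p \<noteq> \<one>"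
      by simp_all
    show "closure_word f p \<in> words_over I"
      "pro_topology V F closure_of generate F {word_eval F x p} =
        generate F {word_eval F x (closure_word f p)}"
      using closure_word_correct[of f, OF f_def *] by simp_all
  qed
qed

end

theorem theorem3p2:
  fixes V :: "nat monoid set" and F :: "('a, 'm) monoid_scheme" and X :: "'a set"
  assumes "pseudovariety V" and "nontrivial_class V" and "extension_closed V"
    and "free_on F X"
  shows "pro_topology V F closure_of generate F {\<one>\<^bsub>F\<^esub>} = generate F {\<one>\<^bsub>F\<^esub>} \<and>
    (\<forall>w \<in> carrier F - {\<one>\<^bsub>F\<^esub>}. let u = grp_root F w; e = grp_exp F w in
      subgroup (pro_topology V F closure_of generate F {w}) (F\<lparr>carrier := generate F {u}\<rparr>) \<and>
      (closedin (pro_topology V F) (generate F {w}) \<longleftrightarrow> in_class (integer_mod_group e) V) \<and>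
      (let m = Max {k. 1 \<le> k \<and> k dvd e \<and> in_class (integer_mod_group k) V} in
        pro_topology V F closure_of generate F {w} = generate F {u [^]\<^bsub>F\<^esub> m})) \<and>
    (decidable_set {n. 2 \<le> n \<and> in_class (integer_mod_group n) V} \<longrightarrow>
      closure_computable V F X)"
proof -
  interpret free_group_pseudovariety F X V
    using assms by unfold_locales
  have "let u = grp_root F w; e = grp_exp F w in
      subgroup (pro_topology V F closure_of generate F {w}) (F\<lparr>carrier := generate F {u}\<rparr>) \<and>
      (closedin (pro_topology V F) (generate F {w}) \<longleftrightarrow> in_class (integer_mod_group e) V) \<and>
      (let m = Max {k. 1 \<le> k \<and> k dvd e \<and> in_class (integer_mod_group k) V} in
        pro_topology V F closure_of generate F {w} = generate F {u [^]\<^bsub>F\<^esub> m})"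
    if w: "w \<in> carrier F - {\<one>\<^bsub>F\<^esub>}" for w
  proof -
    have "w \<in> carrier F"
      using w by simp
    from reduced_word_exists[OF this]
    obtain W where W: "W \<in> words_over X" "reduced W" "eval W = w" .
    moreover from this have "W \<noteq> []"
      using w by auto
    ultimately interpret root: free_group_root F X V "grp_root F w" w "grp_exp F w"
      using free_group_root by blast
    show ?thesis
      unfolding Let_def root.cyclic_divisors_def[symmetric] root.m_def[symmetric]
      using root.closure_subgroup root.closed_iff root.closure_cyclic by blast
  qed
  then show ?thesis
    using closure_one closure_computable_if_decidable by blast
qed

end
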